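(* Let $k\ge2$, $m\ge3$ and $0<\alpha<1$. Among all $k$-uniform hypertrees with $m$ hyperedges, the second last hypertree in $S_\alpha$-order is the starlike hypertree $S^{(k)}_{1,2,1,\dots,1}$ (with $m$ hyperedges in total, i.e. $m-3$ trailing $1$'s).
   Context: Hypergraphs are finite; $k$-uniform means every hyperedge has exactly $k$ vertices; a hypertree is a connected hypergraph without cycles. The hyperpath of length $r$ is obtained from the path graph with $r$ edges by inserting $k-2$ new vertices (of degree one) into each edge. The starlike hypertree $S^{(k)}_{n_1,\dots,n_p}$ ($p\ge1$, $n_i\ge1$) is obtained from $p$ hyperpaths of lengths $n_1,\dots,n_p$ by identifying one end vertex of each into a single common vertex; when all $n_i=1$ it is the hyperstar $S_p^{(k)}$. For a $k$-uniform hypergraph $\mathcal{H}$ on $[n]$, $\mathcal{A}(\mathcal{H})$ is the $k$-order $n$-dimensional tensor with entry $\frac1{(k-1)!}$ at $(i_1,\dots,i_k)$ if $\{i_1,\dots,i_k\}\in E(\mathcal{H})$ and $0$ otherwise; $\mathcal{D}(\mathcal{H})$ is the diagonal tensor of vertex degrees; $\mathcal{A}_\alpha(\mathcal{H})=\alpha\mathcal{D}(\mathcal{H})+(1-\alpha)\mathcal{A}(\mathcal{H})$. For a tensor $\mathcal{T}$, $\mathrm{Tr}_d(\mathcal{T})$ is the sum of the $d$-th powers of all $n(k-1)^{n-1}$ eigenvalues of $\mathcal{T}$ (roots of its characteristic polynomial, with multiplicity); in particular $\mathrm{Tr}_0(\mathcal{T})=n(k-1)^{n-1}$, and for $d\ge1$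 $$\mathrm{Tr}_{d}(\mathcal{T})=(k-1)^{n-1}\sum_{d_1+\cdots+d_n=d}\ \prod_{i=1}^{n}\frac{1}{(d_i(k-1))!}\Big(\sum_{\gamma\in[n]^{k-1}}(\mathcal{T})_{i\gamma}\frac{\partial}{\partial a_{i\gamma}}\Big)^{d_i}\mathrm{tr}\big(A^{d(k-1)}\big),$$ with $A=(a_{ij})$ an $n\times n$ matrix of indeterminates, $d_i\ge0$ integers, $\frac{\partial}{\partial a_{i\gamma}}=\frac{\partial}{\partial a_{i i_2}}\cdots\frac{\partial}{\partial a_{i i_k}}$ for $\gamma=i_2\cdots i_k$. $S_\alpha$-order: for $k$-uniform hypergraphs $\mathcal{H}_1,\mathcal{H}_2$ with $n$ vertices, $\mathcal{H}_1\prec_\alpha\mathcal{H}_2$ if there is $d\in\{1,\dots,n(k-1)^{n-1}-1\}$ with $\mathrm{Tr}_t(\mathcal{A}_\alpha(\mathcal{H}_1))=\mathrm{Tr}_t(\mathcal{A}_\alpha(\mathcal{H}_2))$ for $t=0,\dots,d-1$ and $\mathrm{Tr}_d(\mathcal{A}_\alpha(\mathcal{H}_1))<\mathrm{Tr}_d(\mathcal{A}_\alpha(\mathcal{H}_2))$. "$L$ is the last in a class" means $L$ is in the class and $\mathcal{H}\prec_\alpha L$ for every $\mathcal{H}$ in the class not isomorphic to $L$; "$X$ is the second last" means that the class has a last member $L$, $X$ is in the class and not isomorphic to $L$, and $\mathcal{H}\prec_\alpha X$ for every $\mathcal{H}$ in the class isomorphic to neither $X$ nor $L$. (Here the last hypertree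 is the hyperstar $S_m^{(k)}$.) *)

theory Defs
  imports Complex_Main "HOL-Library.Poly_Mapping" "HOL-Library.FuncSet"
begin

section \<open>Hypergraphs\<close>

record 'a hypergraph =
  verts :: "'a set"
  edges :: "'a set set"

definition hypergraph :: "'a hypergraph \<Rightarrow> bool" where
  "hypergraph H \<longleftrightarrow> finite (verts H) \<and> edges H \<subseteq> Pow (verts H)"

definition uniform :: "nat \<Rightarrow> 'a hypergraph \<Rightarrow> bool" where
  "uniform k H \<longleftrightarrow> (\<forall>e\<in>edges H. card e = k)"

definition degree :: "'a hypergraph \<Rightarrow> 'a \<Rightarrow> nat" where
  "degree H v = card {e \<in> edges H. v \<in> e}"

definition connected_hypergraph :: "'a hypergraph \<Rightarrow> bool" where
  "connected_hypergraph H \<longleftrightarrow>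
     (\<forall>u\<in>verts H. \<forall>v\<in>verts H. (u, v) \<in> {(x, y). \<exists>e\<in>edges H. x \<in> e \<and> y \<in> e}\<^sup>*)"

text \<open>Berge cycles \<open>v\<^sub>0 e\<^sub>0 v\<^sub>1 e\<^sub>1 \<dots> v\<^sub>l\<^sub>-\<^sub>1 e\<^sub>l\<^sub>-\<^sub>1 v\<^sub>0\<close> with \<open>l \<ge> 2\<close>; in particular, two hyperedges
  sharing two vertices form a cycle of length 2.\<close>

definition hypergraph_cycle :: "'a hypergraph \<Rightarrow> 'a list \<Rightarrow> 'a set list \<Rightarrow> bool" where
  "hypergraph_cycle H vs es \<longleftrightarrow>
     length vs \<ge> 2 \<and> length es = length vs \<and> distinct vs \<and> distinct es \<and>
     set vs \<subseteq> verts H \<and> set es \<subseteq> edges H \<and>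
     (\<forall>i<length vs. vs ! i \<in> es ! i \<and> vs ! (Suc i mod length vs) \<in> es ! i)"

definition hypertree :: "'a hypergraph \<Rightarrow> bool" where
  "hypertree H \<longleftrightarrow>
     hypergraph H \<and> connected_hypergraph H \<and> \<not> (\<exists>vs es. hypergraph_cycle H vs es)"

definition hypergraph_iso :: "'a hypergraph \<Rightarrow> 'b hypergraph \<Rightarrow> bool" where
  "hypergraph_iso H K \<longleftrightarrow>
     (\<exists>f. bij_betw f (verts H) (verts K) \<and> edges K = (\<lambda>e. f ` e) ` edges H)"

text \<open>The path vertices are the multiples of \<open>k - 1\<close>; the \<open>k - 2\<close> numbers strictly between two
  consecutive multiples are the vertices inserted into that edge.\<close>

definition hyperpath :: "nat \<Rightarrow> nat \<Rightarrow> nat hypergraph" where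
  "hyperpath k r =
     \<lparr>verts = {0..r * (k - 1)}, edges = (\<lambda>j. {j * (k - 1)..Suc j * (k - 1)}) ` {..<r}\<rparr>"

text \<open>The end vertex \<open>0\<close> of every hyperpath is sent to the common vertex \<open>0\<close>; the other vertices of
  the \<open>i\<close>-th hyperpath are shifted past those of the preceding ones, so that distinct
  hyperpaths share only the vertex \<open>0\<close>.\<close>

definition branch_embed :: "nat \<Rightarrow> nat list \<Rightarrow> nat \<Rightarrow> nat \<Rightarrow> nat" where
  "branch_embed k ns i v = (if v = 0 then 0 else sum_list (take i ns) * (k - 1) + v)"

definition starlike :: "nat \<Rightarrow> nat list \<Rightarrow> nat hypergraph" where
  "starlike k ns =
     \<lparr>verts = (\<Union>i<length ns. branch_embed k ns i ` verts (hyperpath k (ns ! i))),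
      edges = (\<Union>i<length ns. (\<lambda>e. branch_embed k ns i ` e) ` edges (hyperpath k (ns ! i)))\<rparr>"

section \<open>Tensors\<close>

text \<open>A tensor of order \<open>k\<close> with finite index set \<open>V\<close> is a function on index lists; only its values on
  lists of length \<open>k\<close> over \<open>V\<close> matter.\<close>

type_synonym 'a tensor = "'a list \<Rightarrow> real"

text \<open>In a \<open>k\<close>-uniform hypergraph, a list of length \<open>k\<close> whose set is an edge has distinct entries.\<close>

definition adjacency_tensor :: "nat \<Rightarrow> 'a hypergraph \<Rightarrow> 'a tensor" where
  "adjacency_tensor k H is = (if set is \<in> edges H then 1 / fact (k - 1) else 0)"

definition degree_tensor :: "nat \<Rightarrow> 'a hypergraph \<Rightarrow> 'a tensor" where
  "degree_tensor k H is = (if is = replicate k (hd is) then real (degree H (hd is)) else 0)"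

definition A_alpha :: "nat \<Rightarrow> real \<Rightarrow> 'a hypergraph \<Rightarrow> 'a tensor" where
  "A_alpha k \<alpha> H is = \<alpha> * degree_tensor k H is + (1 - \<alpha>) * adjacency_tensor k H is"

section \<open>Traces\<close>

text \<open>Real polynomials in the indeterminates \<open>a\<^sub>i\<^sub>j\<close>: finitely supported maps from monomials
  (exponent vectors) to coefficients.\<close>

type_synonym 'a entry_poly = "(('a \<times> 'a) \<Rightarrow>\<^sub>0 nat) \<Rightarrow>\<^sub>0 real"

definition const_poly :: "real \<Rightarrow> 'a entry_poly" where
  "const_poly c = Poly_Mapping.single 0 c"

definition indet :: "'a \<Rightarrow> 'a \<Rightarrow> 'a entry_poly" where
  "indet i j = Poly_Mapping.single (Poly_Mapping.single (i, j) 1) 1"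

definition partial :: "'a \<Rightarrow> 'a \<Rightarrow> 'a entry_poly \<Rightarrow> 'a entry_poly" where
  "partial i j p =
     (\<Sum>\<mu>\<in>Poly_Mapping.keys p.
        Poly_Mapping.single (\<mu> - Poly_Mapping.single (i, j) 1)
          (real (Poly_Mapping.lookup \<mu> (i, j)) * Poly_Mapping.lookup p \<mu>))"

fun indet_matrix_power :: "'a set \<Rightarrow> nat \<Rightarrow> 'a \<Rightarrow> 'a \<Rightarrow> 'a entry_poly" where
  "indet_matrix_power V 0 i j = (if i = j then 1 else 0)"
| "indet_matrix_power V (Suc r) i j = (\<Sum>l\<in>V. indet i l * indet_matrix_power V r l j)"

definition trace_power :: "'a set \<Rightarrow> nat \<Rightarrow> 'a entry_poly" where
  "trace_power V r = (\<Sum>i\<in>V. indet_matrix_power V r i i)"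

text \<open>The operator \<open>\<Sum>\<^sub>\<gamma> T\<^sub>i\<^sub>\<gamma> \<partial>/\<partial>a\<^sub>i\<^sub>\<gamma>\<close>, where \<open>\<gamma>\<close> runs over \<open>V\<^sup>k\<^sup>-\<^sup>1\<close>.\<close>

definition tensor_diff ::
  "'a set \<Rightarrow> nat \<Rightarrow> 'a tensor \<Rightarrow> 'a \<Rightarrow> 'a entry_poly \<Rightarrow> 'a entry_poly" where
  "tensor_diff V k T i p =
     (\<Sum>\<gamma> | set \<gamma> \<subseteq> V \<and> length \<gamma> = k - 1. const_poly (T (i # \<gamma>)) * foldr (partial i) \<gamma> p)"

text \<open>The Morozov--Shakirov formula for \<open>Tr\<^sub>d\<close> of a tensor of order \<open>k\<close> with index set \<open>V\<close>, that is,
  the sum of the \<open>d\<close>-th powers of its \<open>n (k - 1)\<^sup>n\<^sup>-\<^sup>1\<close> eigenvalues, where \<open>n = card V\<close>. The operators for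
  different \<open>i\<close> commute, so the order of composition is immaterial. Each summand applies an operator
  of order \<open>d (k - 1)\<close> to a form of the same degree and so is a constant polynomial, which is
  read off by \<open>lookup _ 0\<close>.\<close>

definition tensor_trace :: "('a::linorder) set \<Rightarrow> nat \<Rightarrow> 'a tensor \<Rightarrow> nat \<Rightarrow> real" where
  "tensor_trace V k T d =
     (if d = 0 then real (card V * (k - 1) ^ (card V - 1))
      else real ((k - 1) ^ (card V - 1)) *
        (\<Sum>D | D \<in> V \<rightarrow>\<^sub>E {..d} \<and> (\<Sum>i\<in>V. D i) = d.
           Poly_Mapping.lookup
             (foldr
                (\<lambda>i p. const_poly (1 / fact (D i * (k - 1))) * (tensor_diff V k T i ^^ D i) p)
                (sorted_list_of_set V) (trace_power V (d * (k - 1))))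
             0))"

section \<open>The order by traces\<close>

definition S_less ::
  "nat \<Rightarrow> real \<Rightarrow> ('a::linorder) hypergraph \<Rightarrow> ('b::linorder) hypergraph \<Rightarrow> bool" where
  "S_less k \<alpha> H K \<longleftrightarrow>
     card (verts H) = card (verts K) \<and>
     (\<exists>d\<in>{1..card (verts H) * (k - 1) ^ (card (verts H) - 1) - 1}.
        (\<forall>t<d. tensor_trace (verts H) k (A_alpha k \<alpha> H) t
               = tensor_trace (verts K) k (A_alpha k \<alpha> K) t) \<and>
        tensor_trace (verts H) k (A_alpha k \<alpha> H) d
          < tensor_trace (verts K) k (A_alpha k \<alpha> K) d)"

definition S_last ::
  "nat \<Rightarrow> real \<Rightarrow> ('a::linorder) hypergraph set \<Rightarrow> 'a hypergraph \<Rightarrow> bool" where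
  "S_last k \<alpha> C L \<longleftrightarrow> L \<in> C \<and> (\<forall>H\<in>C. \<not> hypergraph_iso H L \<longrightarrow> S_less k \<alpha> H L)"

definition S_second_last ::
  "nat \<Rightarrow> real \<Rightarrow> ('a::linorder) hypergraph set \<Rightarrow> 'a hypergraph \<Rightarrow> bool" where
  "S_second_last k \<alpha> C X \<longleftrightarrow>
     (\<exists>L. S_last k \<alpha> C L \<and> X \<in> C \<and> \<not> hypergraph_iso X L \<and>
        (\<forall>H\<in>C. \<not> hypergraph_iso H X \<and> \<not> hypergraph_iso H L \<longrightarrow> S_less k \<alpha> H X))"

definition uniform_hypertrees :: "nat \<Rightarrow> nat \<Rightarrow> 'a hypergraph set" where
  "uniform_hypertrees k m = {H. hypertree H \<and> uniform k H \<and> card (edges H) = m}"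

end

theory Submission imports Defs
begin

text \<open>The first three traces decide. The coefficient of a monomial in \<open>tr A\<^sup>r\<close> counts the closed walks
  using exactly its arcs, so only index configurations that form a closed walk contribute to
  \<open>Tr\<^sub>d\<close>. For \<open>d = 1\<close> these are the loops and give a multiple of the degree sum; for \<open>d = 2\<close> they
  are the loops, giving \<open>\<alpha>\<^sup>2 \<Sum>\<^sub>v d\<^sub>v\<^sup>2\<close>, and, if \<open>k = 2\<close>, the edges traversed back and forth, giving a
  constant depending on \<open>m\<close> only. Hence \<open>Tr\<^sub>0\<close> and \<open>Tr\<^sub>1\<close> are the same for all \<open>k\<close>-uniform hypertrees
  with \<open>m\<close> edges, and \<open>Tr\<^sub>2\<close> orders them by \<open>\<Sum>\<^sub>v (d\<^sub>v - 1)\<^sup>2\<close>, where \<open>\<Sum>\<^sub>v (d\<^sub>v - 1) = m - 1\<close>.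
  A vertex of degree \<open>m\<close> characterises the hyperstar with the value \<open>(m - 1)\<^sup>2\<close>, maximal degree
  \<open>m - 1\<close> characterises the claimed starlike hypertree with the value \<open>(m - 2)\<^sup>2 + 1\<close>, and if all
  degrees are at most \<open>m - 2\<close> the value is at most \<open>(m - 3) (m - 1) < (m - 2)\<^sup>2 + 1\<close>.\<close>

section \<open>Closed walks and the trace of a power of the indeterminate matrix\<close>

text \<open>A walk is stored as its start together with the list of later vertices, so walks with
  \<open>r\<close> arcs are lists of length \<open>r\<close>. Its arcs form an exponent vector: the
  monomial that the walk contributes to a matrix power.\<close>

fun walk_arcs :: "'a \<Rightarrow> 'a list \<Rightarrow> ('a \<times> 'a) \<Rightarrow>\<^sub>0 nat" where
  "walk_arcs i [] = 0"
| "walk_arcs i (l # w) = Poly_Mapping.single (i, l) 1 + walk_arcs l w"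

text \<open>The monomial that the derivatives \<open>foldr (partial i) \<gamma>\<close>
  remove.\<close>

fun out_arcs :: "'a \<Rightarrow> 'a list \<Rightarrow> ('a \<times> 'a) \<Rightarrow>\<^sub>0 nat" where
  "out_arcs i [] = 0"
| "out_arcs i (j # \<gamma>) = Poly_Mapping.single (i, j) 1 + out_arcs i \<gamma>"

lemma keys_plus_nat:
  fixes f g :: "'b \<Rightarrow>\<^sub>0 nat"
  shows "Poly_Mapping.keys (f + g) = Poly_Mapping.keys f \<union> Poly_Mapping.keys g"
  by (auto simp: in_keys_iff lookup_add)

lemma keys_walk_arcs: "Poly_Mapping.keys (walk_arcs i w) = set (zip (i # w) w)"
  by (induction w arbitrary: i) (auto simp: keys_plus_nat)

lemma keys_out_arcs: "Poly_Mapping.keys (out_arcs i \<gamma>) = Pair i ` set \<gamma>"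
  by (induction \<gamma>) (auto simp: keys_plus_nat)

lemma walk_arcs_replicate: "walk_arcs i (replicate n i) = Poly_Mapping.single (i, i) n"
  by (induction n) (simp_all flip: single_add)

lemma walk_successor:
  "b \<in> set (i # w) \<Longrightarrow> b \<noteq> last (i # w) \<Longrightarrow> \<exists>c. (b, c) \<in> set (zip (i # w) w)"
proof (induction w arbitrary: i)
  case (Cons l w)
  show ?case
  proof (cases "b \<in> set (l # w)")
    case True
    then show ?thesis using Cons.IH[of l] Cons.prems(2) by auto
  next
    case False
    then show ?thesis using Cons.prems(1) by auto
  qed
qed simp

text \<open>Only the last vertex of a walk can lack an outgoing arc. In a closed walk it is the
  start, which is left as soon as there is any arc.\<close>

lemma closed_walk_successor:
  assumes "last (i # w) = i" and "(a, b) \<in> set (zip (i # w) w)"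
  shows "\<exists>c. (b, c) \<in> set (zip (i # w) w)"
proof (cases "b = i")
  case True
  then show ?thesis using assms(2) by (cases w) auto
next
  case False
  then show ?thesis using assms walk_successor[of b i w] by (auto dest: set_zip_rightD)
qed

lemma walk_last_in:
  assumes "\<And>a b. (a, b) \<in> set (zip (i # w) w) \<Longrightarrow> a \<in> S \<Longrightarrow> b \<in> S"
    and "s \<in> set (i # w)" and "s \<in> S"
  shows "last (i # w) \<in> S"
  using assms
proof (induction w arbitrary: i s)
  case (Cons l w)
  have step: "\<And>a b. (a, b) \<in> set (zip (l # w) w) \<Longrightarrow> a \<in> S \<Longrightarrow> b \<in> S"
    using Cons.prems(1) by auto
  obtain s' where "s' \<in> set (l # w)" and "s' \<in> S"
    using Cons.prems by auto
  then have "last (l # w) \<in> S"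
    using Cons.IH[of l s'] step by blast
  then show ?case by simp
qed simp

lemma walk_subset:
  assumes "\<And>a b. (a, b) \<in> set (zip (i # w) w) \<Longrightarrow> a \<in> S \<Longrightarrow> b \<in> S" and "i \<in> S"
  shows "set (i # w) \<subseteq> S"
  using assms
proof (induction w arbitrary: i)
  case (Cons l w)
  have "set (l # w) \<subseteq> S"
    by (rule Cons.IH) (use Cons.prems in auto)
  then show ?case using Cons.prems by simp
qed simp

text \<open>A set closed under the arcs traps the walk: from \<open>s\<close> on it stays in
  \<open>S\<close> up to its end, which is the start, and from the start on everything lies in
  \<open>S\<close>.\<close>

lemma closed_walk_connected:
  assumes "last (i # w) = i"
    and "\<And>a b. (a, b) \<in> set (zip (i # w) w) \<Longrightarrow> a \<in> S \<Longrightarrow> b \<in> S"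
    and "(s, t) \<in> set (zip (i # w) w)" and "s \<in> S"
  shows "set (i # w) \<subseteq> S"
proof -
  have "s \<in> set (i # w)" using assms(3) by (meson in_set_zipE)
  then have "i \<in> S" using walk_last_in[of i w S s] assms by auto
  then show ?thesis using walk_subset[of i w S] assms(2) by blast
qed

lemma finite_walks: "finite V \<Longrightarrow> finite {w. set w \<subseteq> V \<and> length w = r \<and> P w}"
  by (rule finite_subset[OF _ finite_lists_length_eq[of V r]]) auto

lemma indet_matrix_power_walks:
  assumes "finite V"
  shows "indet_matrix_power V r i j =
    (\<Sum>w | set w \<subseteq> V \<and> length w = r \<and> last (i # w) = j. Poly_Mapping.single (walk_arcs i w) 1)"
proof (induction r arbitrary: i)
  case 0
  have "{w. set w \<subseteq> V \<and> length w = 0 \<and> last (i # w) = j} = (if i = j then {[]} else {})"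
    by auto
  then show ?case by simp
next
  case (Suc r)
  let ?W = "\<lambda>i r. {w. set w \<subseteq> V \<and> length w = r \<and> last (i # w) = j}"
  have "indet_matrix_power V (Suc r) i j =
      (\<Sum>l\<in>V. \<Sum>w\<in>?W l r. Poly_Mapping.single (walk_arcs i (l # w)) 1)"
    by (simp add: Suc indet_def sum_distrib_left mult_single)
  also have "\<dots> = (\<Sum>(l, w)\<in>Sigma V (\<lambda>l. ?W l r). Poly_Mapping.single (walk_arcs i (l # w)) 1)"
    by (rule sum.Sigma) (use assms finite_walks[OF assms] in auto)
  \<comment> \<open>Splitting off the first step pairs each next vertex with a remaining
    walk.\<close>
  also have "\<dots> = (\<Sum>w\<in>?W i (Suc r). Poly_Mapping.single (walk_arcs i w) 1)"
    by (rule sum.reindex_bij_witness[of _ "\<lambda>w. (hd w, tl w)" "\<lambda>(l, w). l # w"])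
      (auto simp: length_Suc_conv)
  finally show ?case .
qed

lemma lookup_trace_power:
  assumes "finite V"
  shows "Poly_Mapping.lookup (trace_power V r) \<mu> =
    (\<Sum>i\<in>V. real (card {w. set w \<subseteq> V \<and> length w = r \<and> last (i # w) = i \<and> walk_arcs i w = \<mu>}))"
proof -
  have "Poly_Mapping.lookup (indet_matrix_power V r i i) \<mu> =
      real (card {w. set w \<subseteq> V \<and> length w = r \<and> last (i # w) = i \<and> walk_arcs i w = \<mu>})" for i
  proof -
    let ?W = "{w. set w \<subseteq> V \<and> length w = r \<and> last (i # w) = i}"
    have fin: "finite ?W" by (rule finite_walks[OF assms])
    have "Poly_Mapping.lookup (indet_matrix_power V r i i) \<mu> =
        (\<Sum>w\<in>?W. if walk_arcs i w = \<mu> then 1 else 0)"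
      by (simp add: indet_matrix_power_walks[OF assms] lookup_sum lookup_single when_def)
    also have "\<dots> = real (card {w\<in>?W. walk_arcs i w = \<mu>})"
      using fin by (simp add: sum.If_cases Int_def)
    finally show ?thesis by (simp add: conj_assoc cong: conj_cong)
  qed
  then show ?thesis by (simp add: trace_power_def lookup_sum)
qed

lemma trace_power_closed_walk:
  assumes "finite V" and "Poly_Mapping.lookup (trace_power V r) \<mu> \<noteq> 0"
  obtains i w where "last (i # w) = i" and "set (zip (i # w) w) = Poly_Mapping.keys \<mu>"
proof -
  have "\<exists>i\<in>V. \<exists>w. last (i # w) = i \<and> walk_arcs i w = \<mu>"
  proof (rule ccontr)
    assume "\<not> ?thesis"
    then have empty: "{w. set w \<subseteq> V \<and> length w = r \<and> last (i # w) = i \<and> walk_arcs i w = \<mu>} = {}"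
      if "i \<in> V" for i using that by blast
    have "Poly_Mapping.lookup (trace_power V r) \<mu> = 0"
      unfolding lookup_trace_power[OF assms(1)]
      by (intro sum.neutral ballI) (simp only: empty card.empty of_nat_0)
    then show False using assms(2) by simp
  qed
  then show thesis using that keys_walk_arcs by metis
qed

lemma walk_all_loops:
  "set (zip (j # w) w) \<subseteq> {(i, i)} \<Longrightarrow> w = replicate (length w) i \<and> (w \<noteq> [] \<longrightarrow> j = i)"
  by (induction w arbitrary: j) auto

text \<open>A walk using only the loop at \<open>i\<close> stays at \<open>i\<close>, so one start
  and one walk count. For \<open>r = 0\<close> the empty walk would be counted once per
  vertex.\<close>

lemma lookup_trace_power_loop:
  assumes "finite V" and "i \<in> V" and "r > 0"
  shows "Poly_Mapping.lookup (trace_power V r) (Poly_Mapping.single (i, i) r) = 1"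
proof -
  have W: "{w. set w \<subseteq> V \<and> length w = r \<and> last (j # w) = j \<and>
          walk_arcs j w = Poly_Mapping.single (i, i) r} = (if j = i then {replicate r i} else {})"
    (is "?L = ?R") for j
  proof
    show "?L \<subseteq> ?R"
    proof
      fix w assume w: "w \<in> ?L"
      then have "set (zip (j # w) w) = {(i, i)}"
        using keys_walk_arcs[of j w] assms(3) by simp
      then show "w \<in> ?R" using walk_all_loops[of j w i] w assms(3) by (cases "j = i") auto
    qed
    show "?R \<subseteq> ?L" using assms by (auto simp: walk_arcs_replicate)
  qed
  have "real (card {w. set w \<subseteq> V \<and> length w = r \<and> last (j # w) = j \<and>
      walk_arcs j w = Poly_Mapping.single (i, i) r}) = (if j = i then 1 else 0)" for j
    unfolding W by simp
  then show ?thesis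
    unfolding lookup_trace_power[OF assms(1)] using assms(1,2) by simp
qed

text \<open>The 2 counts the two possible starts of the same back-and-forth walk.\<close>

lemma lookup_trace_power_two_cycle:
  assumes "finite V" and "i \<in> V" and "j \<in> V" and "i \<noteq> j"
  shows "Poly_Mapping.lookup (trace_power V 2)
    (Poly_Mapping.single (i, j) 1 + Poly_Mapping.single (j, i) 1) = 2"
proof -
  let ?\<mu> = "Poly_Mapping.single (i, j) 1 + Poly_Mapping.single (j, i) (1::nat)"
  have W: "{w. set w \<subseteq> V \<and> length w = 2 \<and> last (l # w) = l \<and> walk_arcs l w = ?\<mu>} =
     (if l = i then {[j, i]} else if l = j then {[i, j]} else {})" (is "?L = ?R") for l
  proof
    show "?L \<subseteq> ?R"
    proof
      fix w assume w: "w \<in> ?L"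
      then obtain x where "w = [x, l]" by (auto simp: numeral_2_eq_2 length_Suc_conv)
      moreover have "Poly_Mapping.keys (walk_arcs l w) = {(i, j), (j, i)}"
        using w by (auto simp: keys_plus_nat)
      moreover have "(l, x) \<in> set (zip (l # [x, l]) [x, l])" by simp
      ultimately have "(l, x) \<in> {(i, j), (j, i)}" by (simp only: keys_walk_arcs)
      then show "w \<in> ?R" using assms(4) \<open>w = [x, l]\<close> by auto
    qed
    show "?R \<subseteq> ?L" using assms by (auto simp: add.commute)
  qed
  have "real (card {w. set w \<subseteq> V \<and> length w = 2 \<and> last (l # w) = l \<and> walk_arcs l w = ?\<mu>}) =
      (if l = i then 1 else 0) + (if l = j then 1 else 0)" for l
    unfolding W using assms(4) by auto
  then show ?thesis
    unfolding lookup_trace_power[OF assms(1)] using assms by (simp add: sum.distrib)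
qed

section \<open>The differential operators\<close>

lemma lookup_const_poly_mult: "Poly_Mapping.lookup (const_poly c * p) \<mu> = c * Poly_Mapping.lookup p \<mu>"
  unfolding const_poly_def mult_map_scale_conv_mult[symmetric] by (simp add: map.rep_eq when_def)

lemma const_poly_1: "const_poly 1 = 1"
  by (simp add: const_poly_def)

lemma lookup_partial:
  "Poly_Mapping.lookup (partial i j p) \<mu> =
    real (Poly_Mapping.lookup \<mu> (i, j) + 1) * Poly_Mapping.lookup p (\<mu> + Poly_Mapping.single (i, j) 1)"
proof -
  let ?s = "Poly_Mapping.single (i, j) (1::nat)"
  have eq: "(real (Poly_Mapping.lookup \<nu> (i, j)) * Poly_Mapping.lookup p \<nu> when \<nu> - ?s = \<mu>) =
      (if \<nu> = \<mu> + ?s then real (Poly_Mapping.lookup \<nu> (i, j)) * Poly_Mapping.lookup p \<nu> else 0)" for \<nu>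
  \<comment> \<open>Subtraction of exponents is truncated, so a \<open>\<nu>\<close> free of the
    variable may also be sent to \<open>\<mu>\<close>; such a term carries the factor 0.\<close>
  proof (cases "Poly_Mapping.lookup \<nu> (i, j) = 0")
    case False
    have "\<nu> - ?s = \<mu> \<longleftrightarrow> \<nu> = \<mu> + ?s"
    proof
      assume "\<nu> - ?s = \<mu>"
      then have "\<mu> + ?s = \<nu> - ?s + ?s" by simp
      also have "\<dots> = \<nu>"
        using False by (intro poly_mapping_eqI) (auto simp: lookup_add lookup_minus lookup_single when_def)
      finally show "\<nu> = \<mu> + ?s" ..
    qed simp
    then show ?thesis by (auto simp: when_def)
  qed auto
  have "Poly_Mapping.lookup (partial i j p) \<mu> = (\<Sum>\<nu>\<in>Poly_Mapping.keys p.
      if \<nu> = \<mu> + ?s then real (Poly_Mapping.lookup \<nu> (i, j)) * Poly_Mapping.lookup p \<nu> else 0)"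
    by (simp only: partial_def lookup_sum lookup_single eq)
  also have "\<dots> = real (Poly_Mapping.lookup (\<mu> + ?s) (i, j)) * Poly_Mapping.lookup p (\<mu> + ?s)"
    by (simp add: sum.delta' in_keys_iff)
  finally show ?thesis by (simp add: lookup_add)
qed

text \<open>Sufficient for arguments about supports; the value of the factor is only needed for
  constant lists.\<close>

lemma lookup_foldr_partial:
  "\<exists>c. Poly_Mapping.lookup (foldr (partial i) \<gamma> p) \<mu> = c * Poly_Mapping.lookup p (\<mu> + out_arcs i \<gamma>)"
proof (induction \<gamma> arbitrary: \<mu>)
  case Nil
  then show ?case by (auto intro: exI[of _ 1])
next
  case (Cons j \<gamma>)
  show ?case
    using Cons[of "\<mu> + Poly_Mapping.single (i, j) 1"]
    by (auto simp: lookup_partial add.assoc mult.assoc[symmetric] simp del: of_nat_add of_nat_Suc)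
qed

lemma lookup_foldr_partial_replicate:
  "Poly_Mapping.lookup (foldr (partial i) (replicate n j) p) \<mu> =
    fact (Poly_Mapping.lookup \<mu> (i, j) + n) / fact (Poly_Mapping.lookup \<mu> (i, j)) *
      Poly_Mapping.lookup p (\<mu> + Poly_Mapping.single (i, j) n)"
proof (induction n arbitrary: \<mu>)
  case (Suc n)
  have "\<mu> + Poly_Mapping.single (i, j) 1 + Poly_Mapping.single (i, j) n =
      \<mu> + Poly_Mapping.single (i, j) (Suc n)"
    by (simp add: add.assoc flip: single_add)
  then show ?case
    using Suc[of "\<mu> + Poly_Mapping.single (i, j) 1"]
    by (simp add: lookup_partial lookup_add)
qed simp

lemma lookup_tensor_diff:
  "Poly_Mapping.lookup (tensor_diff V k T i p) \<mu> =
    (\<Sum>\<gamma> | set \<gamma> \<subseteq> V \<and> length \<gamma> = k - 1.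
       T (i # \<gamma>) * Poly_Mapping.lookup (foldr (partial i) \<gamma> p) \<mu>)"
  by (simp add: tensor_diff_def lookup_sum lookup_const_poly_mult)

lemma lookup_tensor_diff_term_nonzero:
  assumes "T (i # \<gamma>) * Poly_Mapping.lookup (foldr (partial i) \<gamma> p) \<mu> \<noteq> 0"
  shows "T (i # \<gamma>) \<noteq> 0 \<and> Poly_Mapping.lookup p (\<mu> + out_arcs i \<gamma>) \<noteq> 0"
  using assms lookup_foldr_partial[of i \<gamma> p \<mu>] by auto

lemma lookup_tensor_diff_nonzero:
  assumes "Poly_Mapping.lookup (tensor_diff V k T i p) \<mu> \<noteq> 0"
  obtains \<gamma> where "set \<gamma> \<subseteq> V" and "length \<gamma> = k - 1" and "T (i # \<gamma>) \<noteq> 0"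
    and "Poly_Mapping.lookup p (\<mu> + out_arcs i \<gamma>) \<noteq> 0"
proof -
  obtain \<gamma> where \<gamma>: "\<gamma> \<in> {\<gamma>. set \<gamma> \<subseteq> V \<and> length \<gamma> = k - 1}"
    and nz: "T (i # \<gamma>) * Poly_Mapping.lookup (foldr (partial i) \<gamma> p) \<mu> \<noteq> 0"
    using assms unfolding lookup_tensor_diff by (rule sum.not_neutral_contains_not_neutral)
  show thesis
    by (rule that[of \<gamma>]) (use \<gamma> lookup_tensor_diff_term_nonzero[of T i \<gamma> p \<mu>, OF nz] in simp_all)
qed

text \<open>Evaluates the operator when the closed-walk condition leaves one candidate list: a
  constant list, or for \<open>k = 2\<close> the other end of an edge.\<close>

lemma lookup_tensor_diff_unique:
  assumes "finite V" and "set \<gamma>0 \<subseteq> V" and "length \<gamma>0 = k - 1"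
    and unique: "\<And>\<gamma>. set \<gamma> \<subseteq> V \<Longrightarrow> length \<gamma> = k - 1 \<Longrightarrow> T (i # \<gamma>) \<noteq> 0 \<Longrightarrow>
      Poly_Mapping.lookup p (\<mu> + out_arcs i \<gamma>) \<noteq> 0 \<Longrightarrow> \<gamma> = \<gamma>0"
  shows "Poly_Mapping.lookup (tensor_diff V k T i p) \<mu> =
    T (i # \<gamma>0) * Poly_Mapping.lookup (foldr (partial i) \<gamma>0 p) \<mu>"
proof -
  let ?G = "{\<gamma>. set \<gamma> \<subseteq> V \<and> length \<gamma> = k - 1}"
  let ?f = "\<lambda>\<gamma>. T (i # \<gamma>) * Poly_Mapping.lookup (foldr (partial i) \<gamma> p) \<mu>"
  have zero: "?f \<gamma> = 0" if "\<gamma> \<in> ?G - {\<gamma>0}" for \<gamma>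
  proof (rule ccontr)
    assume nz: "?f \<gamma> \<noteq> 0"
    then show False
      using that unique[of \<gamma>] lookup_tensor_diff_term_nonzero[of T i \<gamma> p \<mu>, OF nz] by simp
  qed
  have "sum ?f ?G = sum ?f {\<gamma>0}"
    by (rule sum.mono_neutral_right)
      (use assms(2,3) zero in \<open>simp_all add: finite_lists_length_eq[OF assms(1)]\<close>)
  then show ?thesis unfolding lookup_tensor_diff by simp
qed

text \<open>This property is preserved by the operator at \<open>i\<close>, so powers of that operator only see loops.\<close>

definition only_loops_at :: "'a \<Rightarrow> 'a entry_poly \<Rightarrow> bool" where
  "only_loops_at i p \<longleftrightarrow> (\<forall>\<mu>. Poly_Mapping.lookup p \<mu> \<noteq> 0 \<longrightarrow>
     Poly_Mapping.keys \<mu> \<subseteq> {i} \<times> UNIV \<longrightarrow> Poly_Mapping.keys \<mu> \<subseteq> {(i, i)})"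

text \<open>All arcs leave \<open>i\<close>, and the head of each arc must be left again by the
  closed walk, so every head is \<open>i\<close>.\<close>

lemma only_loops_at_trace_power:
  assumes "finite V"
  shows "only_loops_at i (trace_power V r)"
  unfolding only_loops_at_def
proof (intro allI impI)
  fix \<mu> assume "Poly_Mapping.lookup (trace_power V r) \<mu> \<noteq> 0" and \<mu>: "Poly_Mapping.keys \<mu> \<subseteq> {i} \<times> UNIV"
  then obtain j w where w: "last (j # w) = j" "set (zip (j # w) w) = Poly_Mapping.keys \<mu>"
    using trace_power_closed_walk[OF assms] by metis
  show "Poly_Mapping.keys \<mu> \<subseteq> {(i, i)}"
    using closed_walk_successor[OF w(1)] w(2) \<mu> by auto
qed

text \<open>Raising \<open>\<mu>\<close> by arcs out of \<open>i\<close> introduces no other source,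
  so the property of \<open>p\<close> applies to the raised monomial, whose keys include those of
  \<open>\<mu>\<close>.\<close>

lemma only_loops_at_tensor_diff:
  assumes "only_loops_at i p"
  shows "only_loops_at i (tensor_diff V k T i p)"
  unfolding only_loops_at_def
proof (intro allI impI)
  fix \<mu> assume "Poly_Mapping.lookup (tensor_diff V k T i p) \<mu> \<noteq> 0" and "Poly_Mapping.keys \<mu> \<subseteq> {i} \<times> UNIV"
  then show "Poly_Mapping.keys \<mu> \<subseteq> {(i, i)}"
    using assms unfolding only_loops_at_def
    by (elim lookup_tensor_diff_nonzero) (fastforce simp: keys_plus_nat keys_out_arcs)
qed

lemma lookup_tensor_diff_loop:
  assumes "only_loops_at i p" and "finite V" and "i \<in> V" and "k > 0"
  shows "Poly_Mapping.lookup (tensor_diff V k T i p) (Poly_Mapping.single (i, i) s) =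
    T (replicate k i) * (fact (s + (k - 1)) / fact s) *
      Poly_Mapping.lookup p (Poly_Mapping.single (i, i) (s + (k - 1)))"
proof -
  let ?r = "replicate (k - 1) i"
  have "Poly_Mapping.lookup (tensor_diff V k T i p) (Poly_Mapping.single (i, i) s) =
      T (i # ?r) * Poly_Mapping.lookup (foldr (partial i) ?r p) (Poly_Mapping.single (i, i) s)"
  proof (rule lookup_tensor_diff_unique)
    fix \<gamma> assume \<gamma>: "length \<gamma> = k - 1"
      and "Poly_Mapping.lookup p (Poly_Mapping.single (i, i) s + out_arcs i \<gamma>) \<noteq> 0"
    moreover have "Poly_Mapping.keys (Poly_Mapping.single (i, i) s + out_arcs i \<gamma>) \<subseteq> {i} \<times> UNIV"
      by (auto simp: keys_plus_nat keys_out_arcs split: if_splits)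
    ultimately have "Poly_Mapping.keys (Poly_Mapping.single (i, i) s + out_arcs i \<gamma>) \<subseteq> {(i, i)}"
      using assms(1) unfolding only_loops_at_def by blast
    then have "x = i" if "x \<in> set \<gamma>" for x
      using that by (auto simp: keys_plus_nat keys_out_arcs)
    then show "\<gamma> = ?r" using \<gamma> by (intro replicate_eqI)
  qed (use assms in auto)
  moreover have "i # ?r = replicate k i" using assms(4) by (cases k) auto
  ultimately show ?thesis
    by (simp add: lookup_foldr_partial_replicate del: foldr_replicate flip: single_add)
qed

lemma lookup_tensor_diff_power:
  assumes "only_loops_at i p" and "finite V" and "i \<in> V" and "k > 0"
  shows "Poly_Mapping.lookup ((tensor_diff V k T i ^^ d) p) (Poly_Mapping.single (i, i) s) =
    T (replicate k i) ^ d * (fact (s + d * (k - 1)) / fact s) *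
      Poly_Mapping.lookup p (Poly_Mapping.single (i, i) (s + d * (k - 1)))"
\<comment> \<open>The outermost operator is evaluated first and raises \<open>s\<close> by
  \<open>k - 1\<close>, hence the generalisation; the factorial quotients telescope.\<close>
proof (induction d arbitrary: s)
  case (Suc d)
  have loops: "only_loops_at i ((tensor_diff V k T i ^^ n) p)" for n
    by (induction n) (simp_all add: assms only_loops_at_tensor_diff)
  show ?case
    by (simp add: lookup_tensor_diff_loop[OF loops assms(2-4)] Suc add.assoc)
qed simp

text \<open>The factor \<open>fact (d * (k - 1))\<close> is the one that the prefactor in the trace
  formula cancels.\<close>

lemma tensor_diff_power_trace:
  assumes "finite V" and "i \<in> V" and "k \<ge> 2" and "d > 0"
  shows "Poly_Mapping.lookup ((tensor_diff V k T i ^^ d) (trace_power V (d * (k - 1)))) 0 =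
    fact (d * (k - 1)) * T (replicate k i) ^ d"
proof -
  have "k > 0" and "d * (k - 1) > 0" using assms(3,4) by auto
  then show ?thesis
    using lookup_tensor_diff_power[where i = i and k = k and T = T and d = d and s = 0,
        OF only_loops_at_trace_power[OF assms(1), of i "d * (k - 1)"] assms(1,2)]
      lookup_trace_power_loop[OF assms(1,2), of "d * (k - 1)"]
    by (simp add: mult.commute)
qed


text \<open>Arcs leave only \<open>i\<close> and \<open>j\<close>, and every head is left again, so
  all heads are \<open>i\<close> or \<open>j\<close>. If no arc led from \<open>i\<close> to
  \<open>j\<close>, then \<open>{i}\<close> would trap the walk, although it has an arc out of
  \<open>j\<close>.\<close>

lemma two_source_support:
  assumes "finite V" and "i \<noteq> j" and "\<gamma> \<noteq> []" and "\<gamma>' \<noteq> []"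
    and nz: "Poly_Mapping.lookup (trace_power V r) (out_arcs i \<gamma> + out_arcs j \<gamma>') \<noteq> 0"
  shows "set \<gamma> \<subseteq> {i, j} \<and> j \<in> set \<gamma>"
proof -
  obtain l w where closed: "last (l # w) = l"
    and "set (zip (l # w) w) = Poly_Mapping.keys (out_arcs i \<gamma> + out_arcs j \<gamma>')"
    using trace_power_closed_walk[OF assms(1) nz] by metis
  then have arcs: "set (zip (l # w) w) = Pair i ` set \<gamma> \<union> Pair j ` set \<gamma>'"
    by (simp add: keys_plus_nat keys_out_arcs)
  have sub: "set \<gamma> \<subseteq> {i, j}"
  proof
    fix b assume "b \<in> set \<gamma>"
    then have "(i, b) \<in> set (zip (l # w) w)" using arcs by auto
    then obtain c where "(b, c) \<in> set (zip (l # w) w)"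
      using closed_walk_successor[OF closed] by blast
    then show "b \<in> {i, j}" using arcs by auto
  qed
  have "j \<in> set \<gamma>"
  proof (rule ccontr)
    assume "j \<notin> set \<gamma>"
    then have "set \<gamma> \<subseteq> {i}" using sub by auto
    moreover obtain t where "(i, t) \<in> set (zip (l # w) w)"
      using assms(3) arcs by (cases \<gamma>) auto
    ultimately have "set (l # w) \<subseteq> {i}"
      using assms(2) arcs by (intro closed_walk_connected[OF closed, of "{i}" i t]) auto
    moreover obtain u where "(j, u) \<in> set (zip (l # w) w)"
      using assms(4) arcs by (cases \<gamma>') auto
    then have "j \<in> set (l # w)" by (meson in_set_zipE)
    ultimately show False using assms(2) by auto
  qed
  with sub show ?thesis by simp
qed

section \<open>Tensor entries and the mixed second-order terms\<close>

lemma A_alpha_loop: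
  assumes "uniform k H" and "k \<ge> 2"
  shows "A_alpha k \<alpha> H (replicate k i) = \<alpha> * real (degree H i)"
proof -
  have "{i} \<notin> edges H" using assms unfolding uniform_def by force
  moreover have "hd (replicate k i) = i" using assms(2) by (cases k) auto
  ultimately show ?thesis
    using assms(2) by (simp add: A_alpha_def degree_tensor_def adjacency_tensor_def)
qed

lemma A_alpha_not_loop:
  assumes "i # \<gamma> \<noteq> replicate k i"
  shows "A_alpha k \<alpha> H (i # \<gamma>) = (if set (i # \<gamma>) \<in> edges H then (1 - \<alpha>) / fact (k - 1) else 0)"
  using assms by (simp add: A_alpha_def degree_tensor_def adjacency_tensor_def)

text \<open>Off the diagonal a nonzero entry needs an edge as index set; an edge consisting of two
  vertices forces \<open>k = 2\<close>.\<close>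

lemma A_alpha_two_vertices:
  assumes "uniform k H" and "i \<noteq> j" and "length \<gamma> = k - 1"
    and "set \<gamma> \<subseteq> {i, j}" and "j \<in> set \<gamma>" and nz: "A_alpha k \<alpha> H (i # \<gamma>) \<noteq> 0"
  shows "k = 2 \<and> {i, j} \<in> edges H \<and> \<gamma> = [j]"
proof -
  have "i # \<gamma> \<noteq> replicate k i" using assms(2,5) by (metis in_set_replicate list.set_intros(2))
  then have "set (i # \<gamma>) \<in> edges H" using nz by (simp add: A_alpha_not_loop split: if_splits)
  moreover have "set (i # \<gamma>) = {i, j}" using assms(4,5) by auto
  ultimately have e: "{i, j} \<in> edges H" by simp
  then have "k = 2" using assms(1,2) unfolding uniform_def by force
  then show ?thesis using e assms(3,5) by (auto simp: length_Suc_conv)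
qed

text \<open>\<open>two_source_support\<close> is used in both orders: each of the two sources must
  be reached from the other.\<close>

lemma tensor_diff_cross_nonzero:
  assumes "finite V" and "uniform k H" and "k \<ge> 2" and "i \<noteq> j"
    and "length \<gamma> = k - 1" and "A_alpha k \<alpha> H (i # \<gamma>) \<noteq> 0"
    and "length \<gamma>' = k - 1" and "A_alpha k \<alpha> H (j # \<gamma>') \<noteq> 0"
    and nz: "Poly_Mapping.lookup (trace_power V r) (out_arcs i \<gamma> + out_arcs j \<gamma>') \<noteq> 0"
  shows "k = 2 \<and> {i, j} \<in> edges H \<and> \<gamma> = [j] \<and> \<gamma>' = [i]"
proof -
  have ne: "\<gamma> \<noteq> []" "\<gamma>' \<noteq> []" using assms(3,5,7) by auto
  have nz': "Poly_Mapping.lookup (trace_power V r) (out_arcs j \<gamma>' + out_arcs i \<gamma>) \<noteq> 0"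
    using nz by (simp add: add.commute)
  show ?thesis
    using A_alpha_two_vertices[OF assms(2,4,5) _ _ assms(6)]
      A_alpha_two_vertices[OF assms(2) assms(4)[symmetric] assms(7) _ _ assms(8)]
      two_source_support[OF assms(1,4) ne nz]
      two_source_support[OF assms(1) assms(4)[symmetric] ne(2,1) nz'] by blast
qed

lemma tensor_diff_cross:
  fixes H :: "'a hypergraph" and k :: nat and \<alpha> :: real
  defines "T \<equiv> A_alpha k \<alpha> H"
  assumes fin: "finite V" and unif: "uniform k H" and k: "k \<ge> 2" and ij: "i \<in> V" "j \<in> V" "i \<noteq> j"
  shows "Poly_Mapping.lookup
      (tensor_diff V k T i (tensor_diff V k T j (trace_power V (2 * (k - 1))))) 0 =
    (if k = 2 \<and> {i, j} \<in> edges H then 2 * (1 - \<alpha>)\<^sup>2 else 0)"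
proof -
  let ?p = "trace_power V (2 * (k - 1))"
  let ?q = "tensor_diff V k T j ?p"
  note cross = tensor_diff_cross_nonzero[OF fin unif k ij(3), of _ \<alpha>]
  show ?thesis
  proof (cases "k = 2 \<and> {i, j} \<in> edges H")
    case True
    then have k2: "k = 2" and e: "{i, j} \<in> edges H" by auto
    \<comment> \<open>Each operator keeps a single list, the other end of the edge. The two entries
      are \<open>1 - \<alpha>\<close> since \<open>fact (k - 1) = 1\<close>, and the two-cycle
      contributes 2.\<close>
    have "Poly_Mapping.lookup (tensor_diff V k T i ?q) 0 =
        T (i # [j]) * Poly_Mapping.lookup (foldr (partial i) [j] ?q) 0"
    proof (rule lookup_tensor_diff_unique[OF fin])
      fix \<gamma> assume \<gamma>: "length \<gamma> = k - 1" "T (i # \<gamma>) \<noteq> 0"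
        and "Poly_Mapping.lookup ?q (0 + out_arcs i \<gamma>) \<noteq> 0"
      then show "\<gamma> = [j]"
        using cross[of \<gamma>] unfolding T_def by (auto elim!: lookup_tensor_diff_nonzero)
    qed (use ij k2 in auto)
    moreover have "Poly_Mapping.lookup ?q (Poly_Mapping.single (i, j) 1) =
        T (j # [i]) * Poly_Mapping.lookup (foldr (partial j) [i] ?p) (Poly_Mapping.single (i, j) 1)"
    proof (rule lookup_tensor_diff_unique[OF fin])
      fix \<gamma> assume \<gamma>: "length \<gamma> = k - 1" "T (j # \<gamma>) \<noteq> 0"
        and nz: "Poly_Mapping.lookup ?p (Poly_Mapping.single (i, j) 1 + out_arcs j \<gamma>) \<noteq> 0"
      have "set \<gamma> \<subseteq> {j, i} \<and> i \<in> set \<gamma>"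
      proof (rule two_source_support[OF fin ij(3)[symmetric], of \<gamma> "[j]"])
        show "Poly_Mapping.lookup ?p (out_arcs j \<gamma> + out_arcs i [j]) \<noteq> 0"
          using nz by (simp add: add.commute)
      qed (use \<gamma> k2 in auto)
      then show "\<gamma> = [i]" using \<gamma>(1) k2 by (auto simp: length_Suc_conv)
    qed (use ij k2 in auto)
    moreover have "T (i # [j]) = 1 - \<alpha>" "T (j # [i]) = 1 - \<alpha>"
      using A_alpha_not_loop[of i "[j]" k \<alpha> H] A_alpha_not_loop[of j "[i]" k \<alpha> H] e k2 ij(3)
      by (auto simp: T_def numeral_2_eq_2 insert_commute)
    moreover have "Poly_Mapping.lookup ?p (Poly_Mapping.single (i, j) 1 + Poly_Mapping.single (j, i) 1) = 2"
      using lookup_trace_power_two_cycle[OF fin ij] k2 by simp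
    ultimately show ?thesis
      using True ij(3) by (simp add: lookup_partial lookup_single power2_eq_square)
  next
    case False
    \<comment> \<open>A nonzero coefficient would supply one list per operator, and
      \<open>cross\<close> applies to this pair.\<close>
    have "Poly_Mapping.lookup (tensor_diff V k T i ?q) 0 = 0"
      using False cross unfolding T_def
      by (rule_tac ccontr) (fastforce elim!: lookup_tensor_diff_nonzero)
    then show ?thesis by (simp only: False if_False)
  qed
qed

section \<open>The traces of order one and two\<close>

lemma foldr_filter_id:
  assumes "\<And>x. x \<in> set xs \<Longrightarrow> \<not> P x \<Longrightarrow> f x = id"
  shows "foldr f xs = foldr f (filter P xs)"
  using assms by (induction xs) auto

definition trace_term :: "('a::linorder) set \<Rightarrow> nat \<Rightarrow> 'a tensor \<Rightarrow> nat \<Rightarrow> ('a \<Rightarrow> nat) \<Rightarrow> real" where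
  "trace_term V k T d D = Poly_Mapping.lookup
     (foldr (\<lambda>i p. const_poly (1 / fact (D i * (k - 1))) * (tensor_diff V k T i ^^ D i) p)
       (sorted_list_of_set V) (trace_power V (d * (k - 1)))) 0"

lemma tensor_trace_terms:
  "d > 0 \<Longrightarrow> tensor_trace V k T d = real ((k - 1) ^ (card V - 1)) *
     (\<Sum>D | D \<in> V \<rightarrow>\<^sub>E {..d} \<and> (\<Sum>i\<in>V. D i) = d. trace_term V k T d D)"
  by (simp add: tensor_trace_def trace_term_def)

text \<open>Exponent 0 yields the identity operator with prefactor 1, so only the operators at
  active vertices remain.\<close>

lemma trace_term_support:
  assumes "finite V"
  shows "trace_term V k T d D = Poly_Mapping.lookup
     (foldr (\<lambda>i p. const_poly (1 / fact (D i * (k - 1))) * (tensor_diff V k T i ^^ D i) p)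
       (sorted_list_of_set {i\<in>V. D i \<noteq> 0}) (trace_power V (d * (k - 1)))) 0"
proof -
  have "filter (\<lambda>i. D i \<noteq> 0) (sorted_list_of_set V) = sorted_list_of_set {i\<in>V. D i \<noteq> 0}"
    by (rule sorted_distinct_set_unique) (use assms in \<open>auto simp: sorted_wrt_filter\<close>)
  moreover have "foldr (\<lambda>i p. const_poly (1 / fact (D i * (k - 1))) * (tensor_diff V k T i ^^ D i) p)
       (sorted_list_of_set V) =
     foldr (\<lambda>i p. const_poly (1 / fact (D i * (k - 1))) * (tensor_diff V k T i ^^ D i) p)
       (filter (\<lambda>i. D i \<noteq> 0) (sorted_list_of_set V))"
    by (rule foldr_filter_id) (auto simp: const_poly_1)
  ultimately show ?thesis by (simp add: trace_term_def)
qed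

lemma trace_term_single:
  assumes "finite V" and "i \<in> V" and "k \<ge> 2" and "d > 0"
  shows "trace_term V k T d (\<lambda>v\<in>V. if v = i then d else 0) = T (replicate k i) ^ d"
proof -
  have "{v\<in>V. (\<lambda>v\<in>V. if v = i then d else 0) v \<noteq> 0} = {i}" using assms by auto
  then show ?thesis
    using assms tensor_diff_power_trace[OF assms, of T]
    by (simp add: trace_term_support lookup_const_poly_mult)
qed

text \<open>Used to pull the prefactor of the inner vertex out of the outer operator.\<close>

lemma tensor_diff_const_mult:
  "tensor_diff V k T i (const_poly c * p) = const_poly c * tensor_diff V k T i p"
proof (rule poly_mapping_eqI)
  have "Poly_Mapping.lookup (foldr (partial i) \<gamma> (const_poly c * p)) \<mu> =
      c * Poly_Mapping.lookup (foldr (partial i) \<gamma> p) \<mu>" for \<gamma> \<mu>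
    by (induction \<gamma> arbitrary: \<mu>) (simp_all add: lookup_const_poly_mult lookup_partial)
  then show "Poly_Mapping.lookup (tensor_diff V k T i (const_poly c * p)) \<mu> =
      Poly_Mapping.lookup (const_poly c * tensor_diff V k T i p) \<mu>" for \<mu>
    by (simp add: lookup_tensor_diff lookup_const_poly_mult sum_distrib_left mult.left_commute)
qed

lemma trace_term_pair:
  assumes "finite V" and "i \<in> V" and "j \<in> V" and "i < j"
  shows "trace_term V k T d (\<lambda>v\<in>V. if v = i \<or> v = j then 1 else 0) =
    Poly_Mapping.lookup (tensor_diff V k T i (tensor_diff V k T j (trace_power V (d * (k - 1))))) 0 /
      (fact (k - 1))\<^sup>2"
proof -
  have "{v\<in>V. (\<lambda>v\<in>V. if v = i \<or> v = j then 1 else 0) v \<noteq> (0::nat)} = {i, j}" using assms by auto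
  moreover have "sorted_list_of_set {i, j} = [i, j]" using assms(4) by auto
  ultimately show ?thesis
    using assms
    by (simp add: trace_term_support lookup_const_poly_mult tensor_diff_const_mult power2_eq_square)
qed

section \<open>Exponent vectors of total one and two, and the resulting traces\<close>

lemma inj_on_single: "d > 0 \<Longrightarrow> inj_on (\<lambda>i. \<lambda>v\<in>V. if v = i then d else (0::nat)) V"
  by (rule inj_onI) (metis (mono_tags, lifting) gr_implies_not0 restrict_apply')

lemma exponents_1:
  assumes "finite V"
  shows "{D. D \<in> V \<rightarrow>\<^sub>E {..1} \<and> (\<Sum>i\<in>V. D i) = (1::nat)} = (\<lambda>i. \<lambda>v\<in>V. if v = i then 1 else 0) ` V"
    (is "?L = ?R")
proof
  show "?L \<subseteq> ?R"
  proof
    fix D assume "D \<in> ?L"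
    then have ext: "D \<in> V \<rightarrow>\<^sub>E {..1}" and "sum D V = 1" by auto
    then obtain i where "i \<in> V" "D i = 1" "\<forall>v\<in>V. i \<noteq> v \<longrightarrow> D v = 0"
      using sum_eq_1_iff[OF assms, of D] by auto
    then have "D = (\<lambda>v\<in>V. if v = i then 1 else 0)"
      using ext by (auto simp: fun_eq_iff PiE_def extensional_def)
    then show "D \<in> ?R" using \<open>i \<in> V\<close> by blast
  qed
qed (use assms in auto)

lemma exponents_2:
  fixes V :: "'a::linorder set"
  assumes "finite V"
  shows "{D. D \<in> V \<rightarrow>\<^sub>E {..2} \<and> (\<Sum>i\<in>V. D i) = (2::nat)} =
    (\<lambda>i. \<lambda>v\<in>V. if v = i then 2 else 0) ` V \<union>
    (\<lambda>(i, j). \<lambda>v\<in>V. if v = i \<or> v = j then 1 else 0) ` {(i, j). i \<in> V \<and> j \<in> V \<and> i < j}"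
    (is "?L = ?S \<union> ?P")
proof
  show "?L \<subseteq> ?S \<union> ?P"
  proof
    fix D assume "D \<in> ?L"
    then have ext: "D \<in> V \<rightarrow>\<^sub>E {..2}" and sum: "sum D V = 2" by auto
    then obtain i where i: "i \<in> V" "D i \<noteq> 0" by (metis sum.neutral zero_neq_numeral)
    have split: "sum D V = D i + sum D (V - {i})" by (rule sum.remove[OF assms i(1)])
    show "D \<in> ?S \<union> ?P"
    proof (cases "D i = 2")
      case True
      then have "\<forall>v\<in>V - {i}. D v = 0" using split sum assms by simp
      then have "D = (\<lambda>v\<in>V. if v = i then 2 else 0)"
        using ext True by (auto simp: fun_eq_iff PiE_def extensional_def)
      then show ?thesis using i by blast
    next
      case False
      then have "D i = 1" and "sum D (V - {i}) = 1" using i split sum by auto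
      then obtain j where j: "j \<in> V - {i}" "D j = 1" "\<forall>v\<in>V - {i}. j \<noteq> v \<longrightarrow> D v = 0"
        using sum_eq_1_iff[of "V - {i}" D] assms by auto
      have D: "D = (\<lambda>v\<in>V. if v = i \<or> v = j then 1 else 0)"
        using ext j \<open>D i = 1\<close> by (auto simp: fun_eq_iff PiE_def extensional_def)
      then have D': "D = (\<lambda>v\<in>V. if v = j \<or> v = i then 1 else 0)" by (simp add: disj_commute)
      \<comment> \<open>The linear order selects one orientation, so each unordered pair occurs
        once.\<close>
      have "(i, j) \<in> {(i, j). i \<in> V \<and> j \<in> V \<and> i < j} \<or> (j, i) \<in> {(i, j). i \<in> V \<and> j \<in> V \<and> i < j}"
        using i j by auto
      then show ?thesis using D D' by (force simp: image_iff)
    qed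
  qed
next
  have "D \<in> ?L" if P: "D \<in> ?P" for D
  proof -
    obtain i j where ij: "i \<in> V" "j \<in> V" "i < j"
      and D: "D = (\<lambda>v\<in>V. if v = i \<or> v = j then 1 else 0)"
      using P by auto
    have "sum D V = sum D {i, j}"
      by (rule sum.mono_neutral_right) (use assms ij D in auto)
    also have "\<dots> = 2" using ij D by auto
    finally show ?thesis using D by auto
  qed
  moreover have "?S \<subseteq> ?L" using assms by auto
  ultimately show "?S \<union> ?P \<subseteq> ?L" by blast
qed

lemma inj_on_pair:
  "inj_on (\<lambda>(i, j). \<lambda>v\<in>V. if v = i \<or> v = j then 1 else (0::nat))
     {(i, j). i \<in> V \<and> j \<in> V \<and> i < (j::'a::linorder)}"
proof (rule inj_onI, clarify)
  fix i j i' j' :: 'a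
  assume V: "i \<in> V" "j \<in> V" "i' \<in> V" "j' \<in> V" and lt: "i < j" "i' < j'"
    and eq: "(\<lambda>v\<in>V. if v = i \<or> v = j then 1 else (0::nat)) =
      (\<lambda>v\<in>V. if v = i' \<or> v = j' then 1 else 0)"
  have "v = i \<or> v = j \<longleftrightarrow> v = i' \<or> v = j'" if "v \<in> V" for v
    using fun_cong[OF eq, of v] that by (auto split: if_splits)
  then have "{i, j} = {i', j'}" using V by blast
  then show "i = i' \<and> j = j'" using lt by (auto simp: doubleton_eq_iff)
qed

lemma tensor_trace_1:
  assumes "finite (verts H)" and "uniform k H" and "k \<ge> 2"
  shows "tensor_trace (verts H) k (A_alpha k \<alpha> H) 1 =
    real ((k - 1) ^ (card (verts H) - 1)) * (\<alpha> * (\<Sum>v\<in>verts H. real (degree H v)))"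
proof -
  have "(\<Sum>D\<in>(\<lambda>i. \<lambda>v\<in>verts H. if v = i then 1 else 0) ` verts H.
      trace_term (verts H) k (A_alpha k \<alpha> H) 1 D) = (\<Sum>i\<in>verts H. \<alpha> * real (degree H i))"
    using assms by (subst sum.reindex[OF inj_on_single]) (simp_all add: trace_term_single A_alpha_loop del: One_nat_def)
  then show ?thesis
    using exponents_1[OF assms(1)]
    by (simp add: tensor_trace_terms sum_distrib_left)
qed

text \<open>Turns the sum over the increasing pairs of \<open>exponents_2\<close> into a count of
  edges in the graph case.\<close>

lemma card_2_uniform_edges:
  fixes H :: "'a::linorder hypergraph"
  assumes "hypergraph H" and "uniform 2 H"
  shows "card {(i, j). i \<in> verts H \<and> j \<in> verts H \<and> i < j \<and> {i, j} \<in> edges H} = card (edges H)"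
proof -
  have "bij_betw (\<lambda>(i, j). {i, j})
      {(i, j). i \<in> verts H \<and> j \<in> verts H \<and> i < j \<and> {i, j} \<in> edges H} (edges H)"
    unfolding bij_betw_def
  proof
    show "inj_on (\<lambda>(i, j). {i, j})
        {(i, j). i \<in> verts H \<and> j \<in> verts H \<and> i < j \<and> {i, j} \<in> edges H}"
      by (auto simp: inj_on_def doubleton_eq_iff)
    have "e \<in> (\<lambda>(i, j). {i, j}) ` {(i, j). i \<in> verts H \<and> j \<in> verts H \<and> i < j \<and> {i, j} \<in> edges H}"
      if e: "e \<in> edges H" for e
    proof -
      obtain x y where xy: "e = {x, y}" "x \<noteq> y"
        using e assms(2) unfolding uniform_def by (meson card_2_iff)
      then have "e = {min x y, max x y}" "min x y < max x y" by (auto simp: min_def max_def)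
      moreover have "e \<subseteq> verts H" using e assms(1) unfolding hypergraph_def by auto
      ultimately show ?thesis using e by (intro image_eqI[of _ _ "(min x y, max x y)"]) auto
    qed
    then show "(\<lambda>(i, j). {i, j}) ` {(i, j). i \<in> verts H \<and> j \<in> verts H \<and> i < j \<and> {i, j} \<in> edges H} =
        edges H" by auto
  qed
  then show ?thesis by (rule bij_betw_same_card)
qed

lemma tensor_trace_2:
  fixes H :: "'a::linorder hypergraph"
  assumes H: "hypergraph H" and "uniform k H" and "k \<ge> 2"
  shows "tensor_trace (verts H) k (A_alpha k \<alpha> H) 2 = real ((k - 1) ^ (card (verts H) - 1)) *
    (\<alpha>\<^sup>2 * real (\<Sum>v\<in>verts H. (degree H v)\<^sup>2) +
      (if k = 2 then 2 * (1 - \<alpha>)\<^sup>2 * real (card (edges H)) else 0))"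
proof -
  let ?V = "verts H" and ?T = "A_alpha k \<alpha> H"
  let ?t = "trace_term ?V k ?T 2"
  let ?P = "{(i, j). i \<in> ?V \<and> j \<in> ?V \<and> i < j}"
  let ?s = "\<lambda>i. \<lambda>v\<in>?V. if v = i then 2 else (0::nat)"
  let ?d = "\<lambda>(i, j). \<lambda>v\<in>?V. if v = i \<or> v = j then 1 else (0::nat)"
  have fin: "finite ?V" using H by (simp add: hypergraph_def)
  have finP: "finite ?P"
    by (rule finite_subset[of _ "?V \<times> ?V"]) (use fin in auto)
  have disj: "?s ` ?V \<inter> ?d ` ?P = {}"
  proof -
    \<comment> \<open>At \<open>i\<close> the left function is 2 and the right one at most
      1.\<close>
    have "?s i \<noteq> ?d (a, b)" if "i \<in> ?V" for i a b
      using that by (auto dest!: fun_cong[of _ _ i] split: if_splits)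
    then show ?thesis by auto
  qed
  have single: "sum ?t (?s ` ?V) = \<alpha>\<^sup>2 * real (\<Sum>v\<in>?V. (degree H v)\<^sup>2)"
    using assms fin
    by (subst sum.reindex[OF inj_on_single])
      (simp_all add: trace_term_single A_alpha_loop power_mult_distrib sum_distrib_left)
  have "sum ?t (?d ` ?P) = (\<Sum>(i, j)\<in>?P. if k = 2 \<and> {i, j} \<in> edges H then 2 * (1 - \<alpha>)\<^sup>2 else 0)"
  proof -
    have "?t (?d (i, j)) = (if k = 2 \<and> {i, j} \<in> edges H then 2 * (1 - \<alpha>)\<^sup>2 else 0)"
      if "i \<in> ?V" "j \<in> ?V" "i < j" for i j
      using trace_term_pair[OF fin that, of k ?T 2] that
        tensor_diff_cross[OF fin assms(2,3), of i j \<alpha>] by auto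
    then show ?thesis
      by (subst sum.reindex[OF inj_on_pair]) (auto intro!: sum.cong)
  qed
  also have "\<dots> = (\<Sum>x\<in>?P. if k = 2 \<and> {fst x, snd x} \<in> edges H then 2 * (1 - \<alpha>)\<^sup>2 else 0)"
    by (rule sum.cong) auto
  also have "\<dots> = (if k = 2 then 2 * (1 - \<alpha>)\<^sup>2 * real (card {x\<in>?P. {fst x, snd x} \<in> edges H}) else 0)"
    using finP by (simp add: sum.If_cases Int_def mult.commute)
  also have "\<dots> = (if k = 2 then 2 * (1 - \<alpha>)\<^sup>2 * real (card (edges H)) else 0)"
  proof -
    have "{x\<in>?P. {fst x, snd x} \<in> edges H} =
        {(i, j). i \<in> ?V \<and> j \<in> ?V \<and> i < j \<and> {i, j} \<in> edges H}" by auto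
    then show ?thesis using card_2_uniform_edges[OF H] assms(2) by auto
  qed
  finally have pair: "sum ?t (?d ` ?P) =
      (if k = 2 then 2 * (1 - \<alpha>)\<^sup>2 * real (card (edges H)) else 0)" .
  have "sum ?t (?s ` ?V \<union> ?d ` ?P) = sum ?t (?s ` ?V) + sum ?t (?d ` ?P)"
    using fin finP disj by (intro sum.union_disjoint) auto
  then show ?thesis
    using exponents_2[OF fin] single pair by (simp add: tensor_trace_terms)
qed


section \<open>Counting vertices of hypertrees\<close>

abbreviation shared_edge :: "'a hypergraph \<Rightarrow> ('a \<times> 'a) set" where
  "shared_edge H \<equiv> {(x, y). \<exists>e\<in>edges H. x \<in> e \<and> y \<in> e}"

text \<open>A cycle through the new edge would have two distinct vertices in it, each lying also in
  a neighbouring edge of the cycle. That edge is old, and old edges can meet \<open>e\<close> only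
  in \<open>v\<close>.\<close>

lemma hypertree_attach:
  assumes H: "hypertree H" and fin: "finite e" and meet: "e \<inter> verts H = {v}"
  shows "hypertree \<lparr>verts = verts H \<union> e, edges = insert e (edges H)\<rparr>" (is "hypertree ?K")
proof -
  have hg: "hypergraph H" and conn: "connected_hypergraph H"
    and acyclic: "\<And>vs es. \<not> hypergraph_cycle H vs es"
    using H by (auto simp: hypertree_def)
  have sub: "f \<subseteq> verts H" if "f \<in> edges H" for f
    using hg that by (auto simp: hypergraph_def)
  have "hypergraph ?K"
    using hg fin by (auto simp: hypergraph_def)
  moreover have "connected_hypergraph ?K"
  proof -
    have mono: "(shared_edge H)\<^sup>* \<subseteq> (shared_edge ?K)\<^sup>*"
      by (rule rtrancl_mono) auto
    have v: "(x, v) \<in> (shared_edge ?K)\<^sup>* \<and> (v, x) \<in> (shared_edge ?K)\<^sup>*" if "x \<in> verts ?K" for x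
    proof (cases "x \<in> verts H")
      case True
      then show ?thesis
        using conn mono meet unfolding connected_hypergraph_def by blast
    next
      case False
      then have "x \<in> e" using that by simp
      moreover have "v \<in> e" using meet by auto
      ultimately show ?thesis by (auto intro!: r_into_rtrancl)
    qed
    show ?thesis
      unfolding connected_hypergraph_def using v by (meson rtrancl_trans)
  qed
  moreover have False if cyc: "hypergraph_cycle ?K vs es" for vs es
  proof -
    let ?l = "length vs"
    have l: "?l \<ge> 2" "length es = ?l" and dist: "distinct vs" "distinct es"
      and es: "set es \<subseteq> insert e (edges H)"
      and inc: "\<And>i. i < ?l \<Longrightarrow> vs ! i \<in> es ! i \<and> vs ! (Suc i mod ?l) \<in> es ! i"
      using cyc by (auto simp: hypergraph_cycle_def)
    have other: False
      if "i < ?l" "j < ?l" "i \<noteq> j" "es ! i = e" "u \<in> e" "u \<noteq> v" "u \<in> es ! j" for i j u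
    proof -
      have "es ! j \<noteq> e" using that l dist(2) by (metis nth_eq_iff_index_eq)
      then have "es ! j \<in> edges H" using es that(2) l by (metis insertE nth_mem subsetD)
      then have "u \<in> verts H" using sub that(7) by blast
      then show False using that(5,6) meet by blast
    qed
    have new: "es ! i \<noteq> e" if i: "i < ?l" for i
    proof
      assume e: "es ! i = e"
      \<comment> \<open>Cyclic successor and predecessor of \<open>i\<close>: the edge at
        \<open>?j\<close> shares \<open>vs ! ?j\<close> with \<open>e\<close>, the edge at
        \<open>?p\<close> shares \<open>vs ! i\<close>. At least one of these two vertices is not
        \<open>v\<close>.\<close>
      let ?j = "Suc i mod ?l" and ?p = "if i = 0 then ?l - 1 else i - 1"
      have j: "?j < ?l" "?j \<noteq> i" using l(1) i by (auto simp: mod_Suc)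
      have p: "?p < ?l" "?p \<noteq> i" "Suc ?p mod ?l = i" using l(1) i by auto
      have "vs ! ?j \<noteq> vs ! i" using j i dist(1) by (simp add: nth_eq_iff_index_eq)
      then consider "vs ! ?j \<noteq> v" | "vs ! i \<noteq> v" by metis
      then show False
      proof cases
        case 1
        then show ?thesis using other[of i ?j "vs ! ?j"] i j e inc[OF i] inc[OF j(1)] by auto
      next
        case 2
        then show ?thesis using other[of i ?p "vs ! i"] i p e inc[OF i] inc[OF p(1)] by metis
      qed
    qed
    have esH: "set es \<subseteq> edges H"
    proof
      fix f assume "f \<in> set es"
      then obtain i where "i < ?l" "f = es ! i" using l by (metis in_set_conv_nth)
      then show "f \<in> edges H" using new es l by (metis insertE nth_mem subsetD)
    qed
    have "set vs \<subseteq> verts H"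
    proof
      fix x assume "x \<in> set vs"
      then obtain i where "i < ?l" "x = vs ! i" by (metis in_set_conv_nth)
      then show "x \<in> verts H" using inc sub esH l by (metis nth_mem subsetD)
    qed
    then have "hypergraph_cycle H vs es"
      using l dist inc esH by (auto simp: hypergraph_cycle_def)
    then show False using acyclic by blast
  qed
  ultimately show ?thesis unfolding hypertree_def by blast
qed

section \<open>Berge paths in hypertrees and the number of vertices\<close>

lemma hypertree_edges_meet_once:
  assumes "hypertree H" and "e \<in> edges H" and "f \<in> edges H" and "e \<noteq> f"
    and "u \<in> e \<inter> f" and "v \<in> e \<inter> f"
  shows "u = v"
proof (rule ccontr)
  assume "u \<noteq> v"
  have "e \<subseteq> verts H" using assms(1,2) by (auto simp: hypertree_def hypergraph_def)
  then have "hypergraph_cycle H [u, v] [e, f]"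
    using assms \<open>u \<noteq> v\<close> by (auto simp: hypergraph_cycle_def less_Suc_eq numeral_2_eq_2)
  then show False using assms(1) by (auto simp: hypertree_def)
qed

text \<open>\<open>u\<close> and \<open>w\<close> are the ends of a Berge path with vertices in \<open>U\<close> and edges in \<open>F\<close>; a further edge
  through both ends would close it to a cycle.\<close>

definition joined :: "'a set \<Rightarrow> 'a set set \<Rightarrow> 'a \<Rightarrow> 'a \<Rightarrow> bool" where
  "joined U F u w \<longleftrightarrow> (\<exists>vs es. length vs = Suc (length es) \<and> distinct vs \<and> distinct es \<and>
     set vs \<subseteq> U \<and> set es \<subseteq> F \<and> (\<forall>i<length es. vs ! i \<in> es ! i \<and> vs ! Suc i \<in> es ! i) \<and>
     hd vs = u \<and> last vs = w)"

lemma joined_refl: "u \<in> U \<Longrightarrow> joined U F u u"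
  unfolding joined_def by (rule exI[of _ "[u]"], rule exI[of _ "[]"]) simp

lemma joined_mono: "joined U F u w \<Longrightarrow> U \<subseteq> U' \<Longrightarrow> F \<subseteq> F' \<Longrightarrow> joined U' F' u w"
  unfolding joined_def
  by (elim exE, intro exI, elim conjE, intro conjI) (assumption | erule (1) order_trans)+

lemma joined_sym:
  assumes "joined U F u w"
  shows "joined U F w u"
proof -
  obtain vs es where p: "length vs = Suc (length es)" "distinct vs" "distinct es"
    "set vs \<subseteq> U" "set es \<subseteq> F" "\<forall>i<length es. vs ! i \<in> es ! i \<and> vs ! Suc i \<in> es ! i"
    "hd vs = u" "last vs = w"
    using assms unfolding joined_def by metis
  have "rev vs ! i \<in> rev es ! i \<and> rev vs ! Suc i \<in> rev es ! i" if "i < length es" for i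
  proof -
    let ?j = "length es - Suc i"
    have "?j < length es" "Suc ?j = length es - i" using that by auto
    moreover have "rev vs ! i = vs ! (length es - i)" "rev vs ! Suc i = vs ! ?j" "rev es ! i = es ! ?j"
      using that p(1) by (simp_all add: rev_nth)
    ultimately show ?thesis using p(6) by metis
  qed
  then show ?thesis
    unfolding joined_def using p
    by (intro exI[of _ "rev vs"] exI[of _ "rev es"]) (auto simp: hd_rev last_rev)
qed

text \<open>The path is prolonged at its front by \<open>x\<close> and \<open>e\<close>; both are
  fresh, which keeps the lists distinct.\<close>

lemma joined_extend:
  assumes "joined U F w y" and "x \<notin> U" and "e \<notin> F" and "x \<in> e" and "w \<in> e"
  shows "joined (U \<union> e) (insert e F) x y"
proof -
  obtain vs es where p: "length vs = Suc (length es)" "distinct vs" "distinct es"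
    "set vs \<subseteq> U" "set es \<subseteq> F" "\<forall>i<length es. vs ! i \<in> es ! i \<and> vs ! Suc i \<in> es ! i"
    "hd vs = w" "last vs = y"
    using assms unfolding joined_def by metis
  have "vs \<noteq> []" using p(1) by auto
  then have "vs ! 0 = w" using p(7) by (simp add: hd_conv_nth)
  then have "(x # vs) ! i \<in> (e # es) ! i \<and> (x # vs) ! Suc i \<in> (e # es) ! i"
    if "i < length (e # es)" for i
    using that p(6) assms(4,5) by (cases i) auto
  then show ?thesis
    unfolding joined_def using p assms \<open>vs \<noteq> []\<close>
    by (intro exI[of _ "x # vs"] exI[of _ "e # es"]) auto
qed

text \<open>If the ends differed, the path would have an edge and \<open>e\<close> would close it to
  a cycle of length at least 2.\<close>

lemma hypertree_edge_meets_joined_once: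
  assumes "hypertree H" and "F \<subseteq> edges H" and "U \<subseteq> verts H"
    and "joined U F u w" and "e \<in> edges H" and "e \<notin> F" and "u \<in> e" and "w \<in> e"
  shows "u = w"
proof (rule ccontr)
  assume "u \<noteq> w"
  obtain vs es where p: "length vs = Suc (length es)" "distinct vs" "distinct es"
    "set vs \<subseteq> U" "set es \<subseteq> F" "\<forall>i<length es. vs ! i \<in> es ! i \<and> vs ! Suc i \<in> es ! i"
    "hd vs = u" "last vs = w"
    using assms(4) unfolding joined_def by metis
  have "vs \<noteq> []" using p(1) by auto
  then have ends: "vs ! 0 = u" "vs ! length es = w"
    using p(1,7,8) by (simp_all add: hd_conv_nth last_conv_nth)
  then have "es \<noteq> []" using \<open>u \<noteq> w\<close> by auto
  \<comment> \<open>The closing edge sits at index \<open>length es\<close>, where the successor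
    index wraps round to 0.\<close>
  have "vs ! i \<in> (es @ [e]) ! i \<and> vs ! (Suc i mod length vs) \<in> (es @ [e]) ! i"
    if "i < length vs" for i
  proof (cases "i = length es")
    case True
    then show ?thesis using ends p(1) assms(7,8) by simp
  next
    case False
    then show ?thesis using that p(1,6) by (auto simp: nth_append)
  qed
  then have "hypergraph_cycle H vs (es @ [e])"
    using p assms(2,3,5,6) \<open>es \<noteq> []\<close> by (auto simp: hypergraph_cycle_def Suc_le_eq)
  then show False using assms(1) by (auto simp: hypertree_def)
qed

lemma hypertree_finite:
  assumes "hypertree H"
  shows "finite (verts H)" and "finite (edges H)" and "e \<in> edges H \<Longrightarrow> e \<subseteq> verts H"
    and "e \<in> edges H \<Longrightarrow> finite e"
  using assms by (auto simp: hypertree_def hypergraph_def intro: finite_subset)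

lemma connected_vertex_in_edge:
  assumes "connected_hypergraph H" and "u \<in> verts H" and "v \<in> verts H" and "u \<noteq> v"
  shows "v \<in> \<Union>(edges H)"
proof -
  have "(u, v) \<in> (shared_edge H)\<^sup>*" using assms unfolding connected_hypergraph_def by blast
  then show ?thesis using assms(4) by (auto elim: rtranclE)
qed

text \<open>An edge set is grown from \<open>v0\<close>: by connectedness some new edge meets the vertices reached so far,
  by acyclicity in exactly one vertex, and so it adds \<open>k - 1\<close> vertices. The \<open>insert\<close> covers the
  case without edges.\<close>

lemma hypertree_card_verts_aux:
  assumes H: "hypertree H" and unif: "uniform k H" and "k \<ge> 1" and v0: "v0 \<in> verts H"
  shows "card (insert v0 (\<Union>(edges H))) = card (edges H) * (k - 1) + 1"
proof -
  let ?E = "edges H"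
  let ?U = "\<lambda>F. insert v0 (\<Union>F)"
  let ?P = "\<lambda>F. F \<subseteq> ?E \<and> card (?U F) = card F * (k - 1) + 1 \<and>
    (\<forall>u\<in>?U F. \<forall>w\<in>?U F. joined (?U F) F u w)"
  note fin = hypertree_finite[OF H]
  have finP: "finite {F. ?P F}" by (rule finite_subset[of _ "Pow ?E"]) (use fin in auto)
  have "{} \<in> {F. ?P F}" by (auto intro: joined_refl)
  then have "{F. ?P F} \<noteq> {}" by (metis empty_iff)
  \<comment> \<open>The growth is phrased as an inclusion-maximal good edge set, which turns out to
    contain all edges.\<close>
  from finite_has_maximal[OF finP this]
  obtain F where "F \<in> {F. ?P F}" and "\<forall>G\<in>{F. ?P F}. F \<subseteq> G \<longrightarrow> F = G"
    by (elim bexE)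
  then have F: "?P F" and max: "\<And>G. ?P G \<Longrightarrow> F \<subseteq> G \<Longrightarrow> F = G"
    by simp_all
  have UV: "?U F \<subseteq> verts H" using F fin(3) v0 by blast
  have finF: "finite F" "finite (?U F)"
    using F fin UV by (auto intro: finite_subset)
  have "F = ?E"
  proof (rule ccontr)
    assume "F \<noteq> ?E"
    then obtain e0 where e0: "e0 \<in> ?E" "e0 \<notin> F" using F by blast
    have "card e0 = k" using e0 unif by (simp add: uniform_def)
    then obtain y where y: "y \<in> e0" using \<open>k \<ge> 1\<close> by fastforce
    have "\<exists>e\<in>?E - F. e \<inter> ?U F \<noteq> {}"
    proof (rule ccontr)
      assume none: "\<not> ?thesis"
      \<comment> \<open>If no new edge met the reached vertices, a chain of edges from
        \<open>v0\<close> could never leave them, so \<open>y\<close> would be reached and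
        \<open>e0\<close> would meet them after all.\<close>
      have "(v0, y) \<in> (shared_edge H)\<^sup>*"
        using H v0 y e0 fin(3) unfolding hypertree_def connected_hypergraph_def by blast
      then have "y \<in> ?U F"
      proof induction
        case (step a b)
        then obtain e where "e \<in> ?E" "a \<in> e" "b \<in> e" by auto
        then show ?case using none step.IH by blast
      qed simp
      then show False using none y e0 by blast
    qed
    then obtain e w where e: "e \<in> ?E" "e \<notin> F" and w: "w \<in> e" "w \<in> ?U F" by blast
    have meet: "e \<inter> ?U F = {w}"
    proof -
      have "u = w" if "u \<in> e" "u \<in> ?U F" for u
        using hypertree_edge_meets_joined_once[OF H _ UV _ e(1,2) that(1) w(1)] F that(2) w(2)
        by blast
      then show ?thesis using w by blast
    qed
    let ?G = "insert e F"
    have UG: "?U ?G = ?U F \<union> e" by auto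
    have "card (?U ?G) + card (?U F \<inter> e) = card (?U F) + card e"
      unfolding UG using card_Un_Int[of "?U F" e] finF fin(4)[OF e(1)] by simp
    then have "card (?U ?G) + 1 = card F * (k - 1) + 1 + k"
      using meet F unif e(1) by (simp add: Int_commute uniform_def)
    moreover have "card ?G = Suc (card F)" using finF e(2) by simp
    ultimately have "card (?U ?G) = card ?G * (k - 1) + 1" using \<open>k \<ge> 1\<close> by simp
    moreover have "joined (?U ?G) ?G x y" if "x \<in> ?U ?G" "y \<in> ?U ?G" for x y
    proof -
      \<comment> \<open>Old vertices keep their path, a new vertex first crosses \<open>e\<close> to
        \<open>w\<close>, and two vertices of \<open>e\<close> are joined by \<open>e\<close>
        alone.\<close>
      have old: "joined (?U ?G) ?G a b" if "a \<in> ?U F" "b \<in> ?U F" for a b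
        using F that by (auto intro: joined_mono[of "?U F" F])
      have mixed: "joined (?U ?G) ?G a b" if "a \<in> e" "a \<notin> ?U F" "b \<in> ?U F" for a b
        unfolding UG using F that w e(2) by (intro joined_extend[of _ _ w]) auto
      have new: "joined (?U ?G) ?G a b" if "a \<in> e" "b \<in> e" for a b
      proof (cases "a = b")
        case False
        then show ?thesis
          unfolding joined_def using that
          by (intro exI[of _ "[a, b]"] exI[of _ "[e]"]) auto
      qed (use that in \<open>auto intro: joined_refl\<close>)
      show ?thesis
        using that old[of x y] mixed[of x y] joined_sym[OF mixed[of y x]] new[of x y]
        unfolding UG by blast
    qed
    moreover have "?G \<subseteq> ?E" using F e(1) by simp
    ultimately have "F = ?G" by (intro max conjI ballI subset_insertI)
    then show False using e(2) by blast
  qed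
  then show ?thesis using F by blast
qed

section \<open>Degrees in a uniform hypertree with \<open>m\<close> edges\<close>

context
  fixes H :: "'a hypergraph" and k m :: nat
  assumes H: "H \<in> uniform_hypertrees k m" and k: "k \<ge> 2" and m: "m \<ge> 1"
begin

lemma
  shows class_hypertree: "hypertree H" and class_uniform: "uniform k H"
    and class_card_edges: "card (edges H) = m"
  using H by (auto simp: uniform_hypertrees_def)

lemmas class_finite = hypertree_finite[OF class_hypertree]

lemma class_verts: "verts H = \<Union>(edges H)"
proof
  show "\<Union>(edges H) \<subseteq> verts H" using class_finite(3) by blast
  show "verts H \<subseteq> \<Union>(edges H)"
  proof
    fix v assume v: "v \<in> verts H"
    obtain e where e: "e \<in> edges H" using class_card_edges m by fastforce
    \<comment> \<open>Some vertex of \<open>e\<close> differs from \<open>v\<close>, and a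
      connection from it to \<open>v\<close> must end with an edge containing
      \<open>v\<close>.\<close>
    then have "card e \<ge> 2" using class_uniform k by (simp add: uniform_def)
    then have "\<not> e \<subseteq> {v}" using card_mono[of "{v}" e] by auto
    then obtain u where "u \<in> e" "u \<noteq> v" by auto
    then show "v \<in> \<Union>(edges H)"
      using connected_vertex_in_edge[of H u v] class_hypertree class_finite(3)[OF e] v
      by (auto simp: hypertree_def)
  qed
qed

lemma class_card_verts: "card (verts H) = m * (k - 1) + 1"
proof -
  obtain e where e: "e \<in> edges H" using class_card_edges m by fastforce
  then have "e \<noteq> {}" using class_uniform k by (auto simp: uniform_def)
  then obtain v where v: "v \<in> verts H" using class_finite(3)[OF e] by auto
  then have "insert v (\<Union>(edges H)) = verts H" using class_verts by auto
  then show ?thesis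
    using hypertree_card_verts_aux[OF class_hypertree class_uniform _ v] k class_card_edges by simp
qed

lemma class_degree_pos:
  assumes "v \<in> verts H"
  shows "degree H v \<ge> 1"
proof -
  have "{e \<in> edges H. v \<in> e} \<noteq> {}" using assms class_verts by auto
  then have "card {e \<in> edges H. v \<in> e} \<noteq> 0" using class_finite(2) by simp
  then show ?thesis by (simp add: degree_def)
qed

lemma class_degree_sum: "(\<Sum>v\<in>verts H. degree H v) = m * k"
proof -
  have "{v \<in> verts H. v \<in> e} = e" if "e \<in> edges H" for e
    using class_finite(3)[OF that] by auto
  then have "(\<Sum>v\<in>verts H. card {e \<in> edges H. v \<in> e}) = (\<Sum>e\<in>edges H. card e)"
    by (intro sum_multicount_gen class_finite) simp
  also have "\<dots> = m * k"
    using class_uniform class_card_edges by (simp add: uniform_def)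
  finally show ?thesis by (simp add: degree_def)
qed

text \<open>Subtracting the vertex count \<open>m * (k - 1) + 1\<close> from the degree sum
  \<open>m * k\<close> leaves \<open>m - 1\<close>.\<close>

lemma class_excess_sum: "(\<Sum>v\<in>verts H. degree H v - 1) = m - 1"
proof -
  have "degree H v = (degree H v - 1) + 1" if "v \<in> verts H" for v
    using class_degree_pos[OF that] by simp
  then have "(\<Sum>v\<in>verts H. degree H v) = (\<Sum>v\<in>verts H. (degree H v - 1) + 1)"
    by (rule sum.cong[OF refl])
  also have "\<dots> = (\<Sum>v\<in>verts H. degree H v - 1) + (m * (k - 1) + 1)"
    by (simp only: sum.distrib) (simp add: class_card_verts)
  finally have "m * k = (\<Sum>v\<in>verts H. degree H v - 1) + (m * (k - 1) + 1)"
    by (simp add: class_degree_sum)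
  moreover have "m * k = m * (k - 1) + m" using k by (cases k) auto
  ultimately show ?thesis by simp
qed

text \<open>The correction depends only on \<open>m\<close> and \<open>k\<close>, so comparing sums
  of squared degrees amounts to comparing squared excesses. No degree is 0, so the truncated
  difference is exact.\<close>

lemma class_degree_square_sum:
  "(\<Sum>v\<in>verts H. (degree H v)\<^sup>2) =
    (\<Sum>v\<in>verts H. (degree H v - 1)\<^sup>2) + 2 * (m - 1) + (m * (k - 1) + 1)"
proof -
  have "(degree H v)\<^sup>2 = (degree H v - 1)\<^sup>2 + 2 * (degree H v - 1) + 1" if v: "v \<in> verts H" for v
  proof -
    obtain d where "degree H v = Suc d" using class_degree_pos[OF v] by (cases "degree H v") auto
    then show ?thesis by (simp add: power2_eq_square)
  qed
  then have "(\<Sum>v\<in>verts H. (degree H v)\<^sup>2) =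
      (\<Sum>v\<in>verts H. (degree H v - 1)\<^sup>2 + 2 * (degree H v - 1) + 1)"
    by (rule sum.cong[OF refl])
  also have "\<dots> = (\<Sum>v\<in>verts H. (degree H v - 1)\<^sup>2) + 2 * (\<Sum>v\<in>verts H. degree H v - 1) +
      card (verts H)"
    by (simp add: sum.distrib sum_distrib_left sum_Suc)
  also have "\<dots> = (\<Sum>v\<in>verts H. (degree H v - 1)\<^sup>2) + 2 * (m - 1) + (m * (k - 1) + 1)"
    by (simp only: class_excess_sum class_card_verts)
  finally show ?thesis .
qed

lemma class_degree_le: "degree H v \<le> m"
  unfolding degree_def class_card_edges[symmetric]
  by (rule card_mono) (use class_finite(2) in auto)

lemma class_edge_meet:
  assumes "e \<in> edges H" and "f \<in> edges H" and "e \<noteq> f" and "c \<in> e" and "c \<in> f"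
  shows "e \<inter> f = {c}"
proof -
  have "x = c" if "x \<in> e \<inter> f" for x
    by (rule hypertree_edges_meet_once[OF class_hypertree assms(1-3) that]) (use assms(4,5) in simp)
  then show ?thesis using assms(4,5) by blast
qed

text \<open>The other vertices share the remaining excess, and every natural number is at most its
  square.\<close>

lemma class_excess_ge:
  assumes v: "v \<in> verts H"
  shows "(\<Sum>v\<in>verts H. (degree H v - 1)\<^sup>2) \<ge> (degree H v - 1)\<^sup>2 + (m - 1 - (degree H v - 1))"
proof -
  have rest: "(\<Sum>u\<in>verts H - {v}. degree H u - 1) = m - 1 - (degree H v - 1)"
    using sum.remove[OF class_finite(1) v, of "\<lambda>u. degree H u - 1"] class_excess_sum by simp
  have "(\<Sum>u\<in>verts H - {v}. degree H u - 1) \<le> (\<Sum>u\<in>verts H - {v}. (degree H u - 1)\<^sup>2)"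
    by (rule sum_mono) (simp only: power2_eq_square le_square)
  then show ?thesis
    using rest sum.remove[OF class_finite(1) v, of "\<lambda>u. (degree H u - 1)\<^sup>2"] by simp
qed

text \<open>Each square is at most \<open>M\<close> times the excess, and the excesses add up to
  \<open>m - 1\<close>.\<close>

lemma class_excess_le:
  assumes "\<And>v. v \<in> verts H \<Longrightarrow> degree H v - 1 \<le> M"
  shows "(\<Sum>v\<in>verts H. (degree H v - 1)\<^sup>2) \<le> M * (m - 1)"
proof -
  have "(\<Sum>v\<in>verts H. (degree H v - 1)\<^sup>2) \<le> (\<Sum>v\<in>verts H. M * (degree H v - 1))"
    unfolding power2_eq_square by (intro sum_mono mult_right_mono assms) auto
  then show ?thesis by (simp only: sum_distrib_left[symmetric, of M] class_excess_sum)
qed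

text \<open>All edges but \<open>g\<close> contain \<open>c\<close>, and \<open>g\<close> is attached to the edge \<open>e0\<close> at \<open>w\<close>. That \<open>g\<close> meets the star
  around \<open>c\<close> in exactly one vertex follows by counting vertices.\<close>

lemma class_broom:
  assumes m2: "m \<ge> 2" and c: "degree H c = m - 1"
  obtains g e0 w F where "edges H = insert e0 (insert g F)" and "card F = m - 2" and "finite F"
    and "w \<in> e0" and "c \<in> e0" and "w \<noteq> c" and "g \<inter> e0 = {w}"
    and "\<And>e. e \<in> F \<Longrightarrow> e \<inter> (e0 \<union> g) = {c}"
    and "\<And>e f. e \<in> F \<Longrightarrow> f \<in> F \<Longrightarrow> e \<noteq> f \<Longrightarrow> e \<inter> f = {c}"
proof -
  let ?S = "{e \<in> edges H. c \<in> e}" and ?U = "\<Union>{e \<in> edges H. c \<in> e}"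
  have card_S: "card ?S = m - 1" using c by (simp add: degree_def)
  have finS: "finite ?S" using class_finite(2) by simp
  have "card (edges H - ?S) = 1"
    using card_S class_card_edges m2 class_finite(2) by (subst card_Diff_subset) auto
  then obtain g where g: "edges H - ?S = {g}" by (auto simp: card_1_singleton_iff)
  then have gE: "g \<in> edges H" "c \<notin> g" by auto
  have S_meet: "e \<inter> f = {c}" if "e \<in> ?S" "f \<in> ?S" "e \<noteq> f" for e f
    using class_edge_meet[of e f c] that by auto
  have "card ?S \<noteq> 0" using card_S m2 by simp
  then have "?S \<noteq> {}" by (metis card.empty)
  then have U_split: "?U = insert c (\<Union>e\<in>?S. e - {c})" by auto
  \<comment> \<open>The edges through \<open>c\<close> are disjoint apart from \<open>c\<close>, so
    each contributes \<open>k - 1\<close> further vertices.\<close>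
  have card_W: "card (\<Union>e\<in>?S. e - {c}) = (m - 1) * (k - 1)"
  proof -
    have "card (\<Union>e\<in>?S. e - {c}) = (\<Sum>e\<in>?S. card (e - {c}))"
      by (rule card_UN_disjoint) (use finS class_finite(4) S_meet in auto)
    also have "\<dots> = (\<Sum>e\<in>?S. k - 1)"
      by (rule sum.cong) (use class_uniform in \<open>auto simp: uniform_def\<close>)
    finally show ?thesis using card_S by simp
  qed
  have finU: "finite ?U" using finS class_finite(4) by auto
  then have "finite (\<Union>e\<in>?S. e - {c})" by (rule rev_finite_subset) auto
  then have "card ?U = (m - 1) * (k - 1) + 1"
    unfolding U_split using card_W by (subst card_insert_disjoint) auto
  moreover have "?U \<union> g = verts H" using class_verts g by auto
  moreover have "card ?U + card g = card (?U \<union> g) + card (?U \<inter> g)"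
    using card_Un_Int[OF finU class_finite(4)[OF gE(1)]] .
  moreover have "card g = k" using gE class_uniform by (simp add: uniform_def)
  moreover have "m * (k - 1) = (m - 1) * (k - 1) + (k - 1)" using m2 by (cases m) auto
  \<comment> \<open>The star misses exactly \<open>k - 1\<close> vertices of the hypertree, all of
    which must lie in \<open>g\<close>; one of the \<open>k\<close> vertices of \<open>g\<close> is
    left for the star.\<close>
  ultimately have "card (?U \<inter> g) = 1" using class_card_verts k by simp
  then obtain w where w: "?U \<inter> g = {w}" by (auto simp: card_1_singleton_iff)
  then obtain e0 where e0: "e0 \<in> edges H" "c \<in> e0" "w \<in> e0" and wg: "w \<in> g" by blast
  have wc: "w \<noteq> c" using wg gE(2) by blast
  have g_meet: "e \<inter> g \<subseteq> {w}" if "e \<in> ?S" for e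
    using w that by blast
  let ?F = "?S - {e0}"
  show thesis
  proof (rule that[of e0 g ?F w])
    show "edges H = insert e0 (insert g ?F)" using g e0(1,2) by blast
    show "card ?F = m - 2" using card_S e0 finS by simp
    show "finite ?F" using finS by simp
    show "g \<inter> e0 = {w}" using g_meet[of e0] e0 wg by blast
    show "e \<inter> (e0 \<union> g) = {c}" if "e \<in> ?F" for e
      using S_meet[of e e0] g_meet[of e] that e0 wc by blast
    show "e \<inter> f = {c}" if "e \<in> ?F" "f \<in> ?F" "e \<noteq> f" for e f
      using S_meet[of e f] that by blast
  qed (use e0 wc in auto)
qed

end

section \<open>Hypertrees with a vertex of large degree\<close>

text \<open>\<open>F\<close> is a sunflower whose kernel \<open>S\<close> lies in \<open>A\<close>.
  Its petals \<open>e - S\<close> avoid \<open>A\<close> and one another, so \<open>\<phi>\<close>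
  can be extended petal by petal, by arbitrary bijections onto the petals of
  \<open>F'\<close>.\<close>

lemma sunflower_extend:
  assumes "finite F" and "finite F'" and "card F = card F'"
    and \<phi>: "bij_betw \<phi> A A'" and S: "S \<subseteq> A"
    and "\<And>e. e \<in> F \<Longrightarrow> finite e \<and> card e = k \<and> e \<inter> A = S"
    and "\<And>e f. e \<in> F \<Longrightarrow> f \<in> F \<Longrightarrow> e \<noteq> f \<Longrightarrow> e \<inter> f = S"
    and "\<And>e. e \<in> F' \<Longrightarrow> finite e \<and> card e = k \<and> e \<inter> A' = \<phi> ` S"
    and "\<And>e f. e \<in> F' \<Longrightarrow> f \<in> F' \<Longrightarrow> e \<noteq> f \<Longrightarrow> e \<inter> f = \<phi> ` S"
  shows "\<exists>\<psi>. bij_betw \<psi> (A \<union> \<Union>F) (A' \<union> \<Union>F') \<and> (\<forall>x\<in>A. \<psi> x = \<phi> x) \<and> (\<lambda>e. \<psi> ` e) ` F = F'"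
  using assms(1-3,6-)
proof (induction F arbitrary: F')
  case empty
  then show ?case using \<phi> by (intro exI[of _ \<phi>]) auto
next
  case (insert e F)
  let ?S' = "\<phi> ` S"
  have "F' \<noteq> {}" using insert.prems insert.hyps by auto
  then obtain f where f: "f \<in> F'" by auto
  let ?F' = "F' - {f}"
  have F': "F' = insert f ?F'" using f by auto
  have "card F = card ?F'" using insert.prems(1,2) insert.hyps f by simp
  have "\<exists>\<psi>. bij_betw \<psi> (A \<union> \<Union>F) (A' \<union> \<Union>?F') \<and> (\<forall>x\<in>A. \<psi> x = \<phi> x) \<and>
      (\<lambda>e. \<psi> ` e) ` F = ?F'"
  proof (rule insert.IH)
    show "finite ?F'" using insert.prems(1) by simp
    show "card F = card ?F'" by fact
    show "finite e \<and> card e = k \<and> e \<inter> A = S" if "e \<in> F" for e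
      by (rule insert.prems(3)) (use that in simp)
    show "e \<inter> f = S" if "e \<in> F" "f \<in> F" "e \<noteq> f" for e f
      by (rule insert.prems(4)) (use that in simp_all)
    show "finite e \<and> card e = k \<and> e \<inter> A' = ?S'" if "e \<in> ?F'" for e
      by (rule insert.prems(5)) (use that in simp)
    show "e \<inter> f = ?S'" if "e \<in> ?F'" "f \<in> ?F'" "e \<noteq> f" for e f
      by (rule insert.prems(6)) (use that in simp_all)
  qed
  then obtain \<psi> where \<psi>: "bij_betw \<psi> (A \<union> \<Union>F) (A' \<union> \<Union>?F')" "\<forall>x\<in>A. \<psi> x = \<phi> x"
      "(\<lambda>e. \<psi> ` e) ` F = ?F'"
    by (elim exE conjE)
  have e: "finite e" "card e = k" "e \<inter> A = S" using insert.prems(3)[of e] by auto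
  have f': "finite f" "card f = k" "f \<inter> A' = ?S'" using insert.prems(5)[of f] f by auto
  have Se: "S \<subseteq> e" "?S' \<subseteq> f" using e(3) f'(3) by auto
  have "card ?S' = card S"
    using \<phi> S by (auto intro!: card_image inj_on_subset[OF bij_betw_imp_inj_on[OF \<phi>]])
  then have "card (e - S) = card (f - ?S')"
    using e f' Se by (simp add: card_Diff_subset finite_subset)
  \<comment> \<open>Edges and kernels have equal sizes on both sides, hence so do the
    petals.\<close>
  then obtain h where h: "bij_betw h (e - S) (f - ?S')"
    using e(1) f'(1) finite_same_card_bij[of "e - S" "f - ?S'"] by auto
  let ?\<psi> = "\<lambda>x. if x \<in> e - S then h x else \<psi> x"
  have petal: "g \<inter> (e - S) = {}" if "g \<in> insert A F" for g
  proof (cases "g = A")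
    case True
    then show ?thesis using e(3) by auto
  next
    case False
    then have "g \<in> F" using that by auto
    then have "g \<inter> e = S" using insert.prems(4)[of g e] insert.hyps by auto
    then show ?thesis by auto
  qed
  have petal': "g \<inter> (f - ?S') = {}" if "g \<in> insert A' ?F'" for g
  proof (cases "g = A'")
    case True
    then show ?thesis using f'(3) by auto
  next
    case False
    then have "g \<in> F'" "g \<noteq> f" using that by auto
    then have "g \<inter> f = ?S'" using insert.prems(6)[of g f] f by auto
    then show ?thesis by auto
  qed
  have old: "?\<psi> ` g = \<psi> ` g" if "g \<in> insert A F" for g
    using petal[OF that] by (intro image_cong) auto
  have "bij_betw ?\<psi> (A \<union> \<Union>F) (A' \<union> \<Union>?F')"
  proof -
    have "?\<psi> x = \<psi> x" if "x \<in> A \<union> \<Union>F" for x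
    proof -
      have "x \<notin> e - S" using that petal by blast
      then show ?thesis by (rule if_not_P)
    qed
    then have "bij_betw ?\<psi> (A \<union> \<Union>F) (A' \<union> \<Union>?F') = bij_betw \<psi> (A \<union> \<Union>F) (A' \<union> \<Union>?F')"
      by (rule bij_betw_cong)
    then show ?thesis using \<psi>(1) by (rule iffD2)
  qed
  moreover have "bij_betw ?\<psi> (e - S) (f - ?S')"
  proof -
    have "bij_betw ?\<psi> (e - S) (f - ?S') = bij_betw h (e - S) (f - ?S')"
      by (rule bij_betw_cong) (rule if_P)
    then show ?thesis using h by (rule iffD2)
  qed
  moreover have "(A' \<union> \<Union>?F') \<inter> (f - ?S') = {}" using petal' by blast
  ultimately have "bij_betw ?\<psi> ((A \<union> \<Union>F) \<union> (e - S)) ((A' \<union> \<Union>?F') \<union> (f - ?S'))"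
    by (rule bij_betw_combine)
  moreover have "(A \<union> \<Union>F) \<union> (e - S) = A \<union> \<Union>(insert e F)" using S by blast
  moreover have "(A' \<union> \<Union>?F') \<union> (f - ?S') = A' \<union> \<Union>F'"
    using f f'(3) by blast
  ultimately have bij: "bij_betw ?\<psi> (A \<union> \<Union>(insert e F)) (A' \<union> \<Union>F')" by (simp only:)
  have ext: "?\<psi> x = \<phi> x" if "x \<in> A" for x
  proof -
    have "x \<notin> e - S" using petal[of A] that by blast
    then have "?\<psi> x = \<psi> x" by (rule if_not_P)
    also have "\<psi> x = \<phi> x" using \<psi>(2) that by (rule bspec)
    finally show ?thesis .
  qed
  have "?\<psi> ` e = ?\<psi> ` S \<union> ?\<psi> ` (e - S)" using Se(1) by blast
  also have "?\<psi> ` S = ?S'" by (rule image_cong[OF refl]) (rule ext[OF subsetD[OF S]])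
  also have "?\<psi> ` (e - S) = h ` (e - S)" by (rule image_cong[OF refl]) (rule if_P)
  also have "h ` (e - S) = f - ?S'" using h by (simp add: bij_betw_def)
  also have "?S' \<union> (f - ?S') = f" using Se(2) by auto
  finally have "?\<psi> ` e = f" .
  moreover have "(\<lambda>e. ?\<psi> ` e) ` F = ?F'"
    unfolding \<psi>(3)[symmetric] by (rule image_cong) (use old in auto)
  ultimately have "(\<lambda>e. ?\<psi> ` e) ` insert e F = F'"
    using F' by (simp only: image_insert)
  then show ?case by (intro exI[of _ ?\<psi>] conjI ballI bij ext)
qed

text \<open>A vertex of degree \<open>m\<close> lies in every edge, so both hypertrees are
  sunflowers with a one-vertex kernel.\<close>

lemma full_degree_iso:
  assumes H: "H \<in> uniform_hypertrees k m" and K: "K \<in> uniform_hypertrees k m"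
    and k: "k \<ge> 2" and m: "m \<ge> 1" and u: "degree H u = m" and v: "degree K v = m"
  shows "hypergraph_iso H K"
proof -
  have "card {e \<in> edges H. u \<in> e} = card (edges H)" "card {e \<in> edges K. v \<in> e} = card (edges K)"
    using u v unfolding degree_def by (simp_all only: class_card_edges[OF H k m] class_card_edges[OF K k m])
  then have "{e \<in> edges H. u \<in> e} = edges H" "{e \<in> edges K. v \<in> e} = edges K"
    using card_subset_eq[OF class_finite(2)[OF H k m] Collect_restrict]
      card_subset_eq[OF class_finite(2)[OF K k m] Collect_restrict] by simp_all
  then have cent: "\<And>e. e \<in> edges H \<Longrightarrow> u \<in> e" "\<And>e. e \<in> edges K \<Longrightarrow> v \<in> e" by blast+
  have card: "\<And>e. e \<in> edges H \<Longrightarrow> card e = k" "\<And>e. e \<in> edges K \<Longrightarrow> card e = k"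
    using class_uniform[OF H k m] class_uniform[OF K k m] by (auto simp: uniform_def)
  have "\<exists>\<psi>. bij_betw \<psi> ({u} \<union> \<Union>(edges H)) ({v} \<union> \<Union>(edges K)) \<and>
      (\<forall>x\<in>{u}. \<psi> x = (\<lambda>_. v) x) \<and> (\<lambda>e. \<psi> ` e) ` edges H = edges K"
  proof (rule sunflower_extend[where S = "{u}" and k = k])
    show "bij_betw (\<lambda>_. v) {u} {v}" by (auto simp: bij_betw_def)
    show "finite (edges H)" "finite (edges K)" "card (edges H) = card (edges K)"
      using class_finite(2)[OF H k m] class_finite(2)[OF K k m] class_card_edges[OF H k m]
        class_card_edges[OF K k m] by auto
    show "finite e \<and> card e = k \<and> e \<inter> {u} = {u}" if "e \<in> edges H" for e
      using card(1)[OF that] cent(1)[OF that] class_finite(4)[OF H k m that] by simp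
    show "finite e \<and> card e = k \<and> e \<inter> {v} = (\<lambda>_. v) ` {u}" if "e \<in> edges K" for e
      using card(2)[OF that] cent(2)[OF that] class_finite(4)[OF K k m that] by simp
    show "e \<inter> f = {u}" if "e \<in> edges H" "f \<in> edges H" "e \<noteq> f" for e f
      by (rule class_edge_meet[OF H k m that cent(1)[OF that(1)] cent(1)[OF that(2)]])
    show "e \<inter> f = (\<lambda>_. v) ` {u}" if "e \<in> edges K" "f \<in> edges K" "e \<noteq> f" for e f
      using class_edge_meet[OF K k m that cent(2)[OF that(1)] cent(2)[OF that(2)]] by simp
  qed auto
  then obtain \<psi> where \<psi>: "bij_betw \<psi> ({u} \<union> \<Union>(edges H)) ({v} \<union> \<Union>(edges K))"
      "(\<lambda>e. \<psi> ` e) ` edges H = edges K" by blast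
  have "edges H \<noteq> {}" "edges K \<noteq> {}"
    using class_card_edges[OF H k m] class_card_edges[OF K k m] m by auto
  then have "{u} \<union> \<Union>(edges H) = verts H" "{v} \<union> \<Union>(edges K) = verts K"
    unfolding class_verts[OF H k m] class_verts[OF K k m] using cent by blast+
  then show ?thesis using \<psi> unfolding hypergraph_iso_def by (intro exI[of _ \<psi>]) simp
qed

text \<open>The decomposition of \<open>class_broom\<close> is rebuilt by three extensions: the edge
  carrying \<open>c\<close> and \<open>w\<close>, then the edge attached at \<open>w\<close>, then
  the remaining edges at \<open>c\<close>.\<close>

lemma broom_iso:
  assumes H: "H \<in> uniform_hypertrees k m" and K: "K \<in> uniform_hypertrees k m"
    and k: "k \<ge> 2" and m: "m \<ge> 2" and c: "degree H c = m - 1" and c': "degree K c' = m - 1"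
  shows "hypergraph_iso H K"
proof -
  have m1: "m \<ge> 1" using m by simp
  obtain g e w F where b: "edges H = insert e (insert g F)" "card F = m - 2" "finite F"
      "w \<in> e" "c \<in> e" "w \<noteq> c" "g \<inter> e = {w}" "\<And>f. f \<in> F \<Longrightarrow> f \<inter> (e \<union> g) = {c}"
      "\<And>f f'. f \<in> F \<Longrightarrow> f' \<in> F \<Longrightarrow> f \<noteq> f' \<Longrightarrow> f \<inter> f' = {c}"
    by (rule class_broom[OF H k m1 m c]) (rule that; assumption)
  obtain g' e' w' F' where b': "edges K = insert e' (insert g' F')" "card F' = m - 2" "finite F'"
      "w' \<in> e'" "c' \<in> e'" "w' \<noteq> c'" "g' \<inter> e' = {w'}" "\<And>f. f \<in> F' \<Longrightarrow> f \<inter> (e' \<union> g') = {c'}"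
      "\<And>f f'. f \<in> F' \<Longrightarrow> f' \<in> F' \<Longrightarrow> f \<noteq> f' \<Longrightarrow> f \<inter> f' = {c'}"
    by (rule class_broom[OF K k m1 m c']) (rule that; assumption)
  have card: "\<And>f. f \<in> edges H \<Longrightarrow> finite f \<and> card f = k" "\<And>f. f \<in> edges K \<Longrightarrow> finite f \<and> card f = k"
    using class_uniform[OF H k m1] class_uniform[OF K k m1]
      class_finite(4)[OF H k m1] class_finite(4)[OF K k m1] by (auto simp: uniform_def)
  have fin: "finite e \<and> card e = k" "finite g \<and> card g = k" "\<And>f. f \<in> F \<Longrightarrow> finite f \<and> card f = k"
    by (simp_all add: card(1) b(1))
  have fin': "finite e' \<and> card e' = k" "finite g' \<and> card g' = k" "\<And>f. f \<in> F' \<Longrightarrow> finite f \<and> card f = k"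
    by (simp_all add: card(2) b'(1))
  let ?\<phi> = "\<lambda>x. if x = c then c' else w'"
  \<comment> \<open>A sunflower with one edge and kernel \<open>{c, w}\<close>: the bijection
    between the edges is made to respect both marked vertices.\<close>
  have "\<exists>\<psi>. bij_betw \<psi> ({c, w} \<union> \<Union>{e}) ({c', w'} \<union> \<Union>{e'}) \<and>
      (\<forall>x\<in>{c, w}. \<psi> x = ?\<phi> x) \<and> (\<lambda>e. \<psi> ` e) ` {e} = {e'}"
  proof (rule sunflower_extend[where S = "{c, w}" and k = k])
    show "bij_betw ?\<phi> {c, w} {c', w'}" using b(6) b'(6) by (auto simp: bij_betw_def)
    show "finite f \<and> card f = k \<and> f \<inter> {c, w} = {c, w}" if "f \<in> {e}" for f
      using that fin(1) b(4,5) by simp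
    show "finite f \<and> card f = k \<and> f \<inter> {c', w'} = ?\<phi> ` {c, w}" if "f \<in> {e'}" for f
      using that fin'(1) b'(4,5) b(6) by (simp add: insert_commute)
  qed simp_all
  then obtain \<psi>1 where "bij_betw \<psi>1 ({c, w} \<union> \<Union>{e}) ({c', w'} \<union> \<Union>{e'})"
      "\<forall>x\<in>{c, w}. \<psi>1 x = ?\<phi> x" by (elim exE conjE)
  moreover have "{c, w} \<union> \<Union>{e} = e" "{c', w'} \<union> \<Union>{e'} = e'" using b(4,5) b'(4,5) by auto
  ultimately have 1: "bij_betw \<psi>1 e e'" "\<psi>1 c = c'" "\<psi>1 w = w'"
    using b(6) by simp_all
  have "\<exists>\<psi>. bij_betw \<psi> (e \<union> \<Union>{g}) (e' \<union> \<Union>{g'}) \<and>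
      (\<forall>x\<in>e. \<psi> x = \<psi>1 x) \<and> (\<lambda>e. \<psi> ` e) ` {g} = {g'}"
  proof (rule sunflower_extend[where S = "{w}" and k = k])
    show "bij_betw \<psi>1 e e'" by fact
    show "finite f \<and> card f = k \<and> f \<inter> e = {w}" if "f \<in> {g}" for f
      using that fin(2) b(7) by simp
    show "finite f \<and> card f = k \<and> f \<inter> e' = \<psi>1 ` {w}" if "f \<in> {g'}" for f
      using that fin'(2) b'(7) 1(3) by simp
  qed (use b(4) in simp_all)
  then obtain \<psi>2 where 2: "bij_betw \<psi>2 (e \<union> g) (e' \<union> g')" "\<forall>x\<in>e. \<psi>2 x = \<psi>1 x" "\<psi>2 ` g = g'"
    by auto
  have c2: "\<psi>2 c = c'" using 1(2) 2(2) b(5) by simp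
  have "\<exists>\<psi>. bij_betw \<psi> ((e \<union> g) \<union> \<Union>F) ((e' \<union> g') \<union> \<Union>F') \<and>
      (\<forall>x\<in>e \<union> g. \<psi> x = \<psi>2 x) \<and> (\<lambda>e. \<psi> ` e) ` F = F'"
  proof (rule sunflower_extend[where S = "{c}" and k = k])
    show "finite f \<and> card f = k \<and> f \<inter> (e \<union> g) = {c}" if "f \<in> F" for f
      using fin(3)[OF that] b(8)[OF that] by simp
    show "finite f \<and> card f = k \<and> f \<inter> (e' \<union> g') = \<psi>2 ` {c}" if "f \<in> F'" for f
      using fin'(3)[OF that] b'(8)[OF that] c2 by simp
    show "f \<inter> f' = {c}" if "f \<in> F" "f' \<in> F" "f \<noteq> f'" for f f'
      by (rule b(9)[OF that])
    show "f \<inter> f' = \<psi>2 ` {c}" if "f \<in> F'" "f' \<in> F'" "f \<noteq> f'" for f f'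
      using b'(9)[OF that] c2 by simp
    show "bij_betw \<psi>2 (e \<union> g) (e' \<union> g')" by fact
    show "card F = card F'" using b(2) b'(2) by simp
  qed (use b(3,5) b'(3) in simp_all)
  then obtain \<psi> where 3: "bij_betw \<psi> ((e \<union> g) \<union> \<Union>F) ((e' \<union> g') \<union> \<Union>F')"
      "\<forall>x\<in>e \<union> g. \<psi> x = \<psi>2 x" "(\<lambda>e. \<psi> ` e) ` F = F'" by (elim exE conjE)
  have "\<psi> ` g = \<psi>2 ` g" "\<psi> ` e = \<psi>1 ` e" using 3(2) 2(2) by (auto intro!: image_cong)
  then have "\<psi> ` g = g'" "\<psi> ` e = e'" using 1(1) 2(3) by (auto simp: bij_betw_def)
  then have "edges K = (\<lambda>e. \<psi> ` e) ` edges H" using 3(3) b(1) b'(1) by simp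
  moreover have "verts H = (e \<union> g) \<union> \<Union>F" "verts K = (e' \<union> g') \<union> \<Union>F'"
    by (simp_all add: class_verts[OF H k m1] class_verts[OF K k m1] b(1) b'(1) Un_assoc)
  ultimately show ?thesis using 3(1) unfolding hypergraph_iso_def by (intro exI[of _ \<psi>]) simp
qed

lemma degree_iso:
  assumes "hypergraph H" and f: "bij_betw f (verts H) (verts K)"
    and edges: "edges K = (\<lambda>e. f ` e) ` edges H" and v: "v \<in> verts H"
  shows "degree K (f v) = degree H v"
proof -
  have inj: "inj_on f (verts H)" using f by (simp add: bij_betw_def)
  have sub: "e \<subseteq> verts H" if "e \<in> edges H" for e using assms(1) that by (auto simp: hypergraph_def)
  have "{e \<in> edges K. f v \<in> e} = (\<lambda>e. f ` e) ` {e \<in> edges H. v \<in> e}"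
  proof -
    have "f v \<in> f ` e \<longleftrightarrow> v \<in> e" if "e \<in> edges H" for e
      by (rule inj_on_image_mem_iff[OF inj v sub[OF that]])
    then have "{e \<in> edges H. f v \<in> f ` e} = {e \<in> edges H. v \<in> e}" by blast
    moreover have "{e \<in> edges K. f v \<in> e} = (\<lambda>e. f ` e) ` {e \<in> edges H. f v \<in> f ` e}"
      unfolding edges by blast
    ultimately show ?thesis by simp
  qed
  moreover have "inj_on (\<lambda>e. f ` e) {e \<in> edges H. v \<in> e}"
    using sub by (intro inj_on_subset[OF inj_on_image_Pow[OF inj]]) auto
  ultimately show ?thesis by (simp add: degree_def card_image)
qed


section \<open>Starlike hypertrees\<close>

lemma branch_embed_snoc:
  assumes "i < length ns"
  shows "branch_embed k (ns @ [n]) i = branch_embed k ns i"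
  using assms by (simp add: branch_embed_def fun_eq_iff)

text \<open>The offset of a branch depends only on the branches before it, so appending one changes
  no earlier embedding; the new offset is the full \<open>sum_list ns\<close>.\<close>

lemma starlike_snoc:
  fixes k n :: nat and ns :: "nat list"
  defines "f \<equiv> \<lambda>v. if v = 0 then 0 else sum_list ns * (k - 1) + v"
  shows "verts (starlike k (ns @ [n])) = verts (starlike k ns) \<union> f ` {0..n * (k - 1)}"
    and "edges (starlike k (ns @ [n])) =
      edges (starlike k ns) \<union> (\<lambda>j. f ` {j * (k - 1)..Suc j * (k - 1)}) ` {..<n}"
proof -
  have last: "branch_embed k (ns @ [n]) (length ns) = f"
    by (simp add: branch_embed_def f_def fun_eq_iff)
  have split: "{..<length (ns @ [n])} = insert (length ns) {..<length ns}" by auto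
  have old: "(\<Union>i<length ns. g (branch_embed k (ns @ [n]) i) ((ns @ [n]) ! i)) =
      (\<Union>i<length ns. g (branch_embed k ns i) (ns ! i))" for g :: "_ \<Rightarrow> _ \<Rightarrow> 'b set"
    by (rule SUP_cong) (simp_all add: branch_embed_snoc nth_append)
  show "verts (starlike k (ns @ [n])) = verts (starlike k ns) \<union> f ` {0..n * (k - 1)}"
    unfolding starlike_def split UN_insert
    using old[of "\<lambda>f n. f ` verts (hyperpath k n)"]
    by (simp add: last hyperpath_def Un_commute)
  show "edges (starlike k (ns @ [n])) =
      edges (starlike k ns) \<union> (\<lambda>j. f ` {j * (k - 1)..Suc j * (k - 1)}) ` {..<n}"
    unfolding starlike_def split UN_insert
    using old[of "\<lambda>f n. (\<lambda>e. f ` e) ` edges (hyperpath k n)"]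
    by (simp add: last hyperpath_def Un_commute image_image)
qed

definition starlike_spec :: "nat \<Rightarrow> nat list \<Rightarrow> nat hypergraph \<Rightarrow> bool" where
  "starlike_spec k ns H \<longleftrightarrow> hypertree H \<and> uniform k H \<and> card (edges H) = sum_list ns \<and>
     verts H = {0..sum_list ns * (k - 1)} \<and> degree H 0 = length (filter (\<lambda>n. n \<noteq> 0) ns)"

text \<open>An empty branch contributes just the centre. The empty list is treated separately
  because its hypergraph has no vertex and violates the specification.\<close>

lemma starlike_snoc_0:
  assumes "ns = [] \<or> starlike_spec k ns (starlike k ns)"
  shows "starlike_spec k (ns @ [0]) (starlike k (ns @ [0]))"
proof (cases "ns = []")
  case True
  have "verts (starlike k [0]) = {0}" "edges (starlike k [0]) = {}"
    by (simp_all add: starlike_def hyperpath_def branch_embed_def lessThan_Suc)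
  then show ?thesis
    unfolding starlike_spec_def hypertree_def True
    by (auto simp: hypergraph_def connected_hypergraph_def uniform_def hypergraph_cycle_def degree_def)
next
  case False
  then have spec: "starlike_spec k ns (starlike k ns)" using assms by simp
  then have "0 \<in> verts (starlike k ns)" by (simp add: starlike_spec_def)
  then have "starlike k (ns @ [0]) = starlike k ns"
    using starlike_snoc[of k ns 0] by (intro hypergraph.equality) auto
  then show ?thesis using spec by (simp add: starlike_spec_def)
qed

text \<open>Lengthening the last branch attaches one pendant edge at the old end of that branch, so
  \<open>hypertree_attach\<close> applies.\<close>

lemma starlike_snoc_Suc:
  assumes spec: "starlike_spec k (ns @ [n]) (starlike k (ns @ [n]))" and k: "k \<ge> 2"
  shows "starlike_spec k (ns @ [Suc n]) (starlike k (ns @ [Suc n]))"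
proof -
  let ?H = "starlike k (ns @ [n])" and ?K = "starlike k (ns @ [Suc n])"
  define f where "f = (\<lambda>v. if v = 0 then 0 else sum_list ns * (k - 1) + v)"
  let ?e = "f ` {n * (k - 1)..Suc n * (k - 1)}"
  let ?N = "(sum_list ns + n) * (k - 1)"
  have H: "hypertree ?H" "uniform k ?H" "card (edges ?H) = sum_list ns + n" "verts ?H = {0..?N}"
      "degree ?H 0 = length (filter (\<lambda>n. n \<noteq> 0) (ns @ [n]))"
    using spec by (simp_all add: starlike_spec_def)
  have "{0..Suc n * (k - 1)} = {0..n * (k - 1)} \<union> {n * (k - 1)..Suc n * (k - 1)}" by auto
  then have vK: "verts ?K = verts ?H \<union> ?e"
    using starlike_snoc(1)[of k ns, folded f_def] by (simp only: image_Un Un_assoc)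
  have eK: "edges ?K = insert ?e (edges ?H)"
    using starlike_snoc(2)[of k ns, folded f_def] by (simp only: lessThan_Suc image_insert Un_insert_right)
  have K: "?K = \<lparr>verts = verts ?H \<union> ?e, edges = insert ?e (edges ?H)\<rparr>"
    using vK eK by (intro hypergraph.equality) simp_all
  have f_gt: "f v > ?N" if "v > n * (k - 1)" for v
    using that by (simp add: f_def add_mult_distrib)
  \<comment> \<open>For \<open>n = 0\<close> the branch is still empty and its first edge is
    attached at the centre instead of at the largest vertex \<open>?N\<close>.\<close>
  have f_first: "f (n * (k - 1)) = (if n = 0 then 0 else ?N)"
    using k by (simp add: f_def add_mult_distrib)
  have range: "{n * (k - 1)..Suc n * (k - 1)} = insert (n * (k - 1)) {n * (k - 1)<..Suc n * (k - 1)}"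
    by auto
  have meet: "?e \<inter> verts ?H = {f (n * (k - 1))}"
  proof -
    have "f (n * (k - 1)) \<in> verts ?H" unfolding f_first H(4) by simp
    moreover have "f v \<notin> verts ?H" if "v \<in> {n * (k - 1)<..Suc n * (k - 1)}" for v
    proof -
      have "v > n * (k - 1)" using that by simp
      then have "?N < f v" by (rule f_gt)
      then show ?thesis unfolding H(4) by (meson atLeastAtMost_iff leD)
    qed
    ultimately show ?thesis unfolding range by blast
  qed
  have tree: "hypertree ?K"
    unfolding K by (rule hypertree_attach[OF H(1) _ meet]) simp
  have "inj f" by (auto simp: f_def inj_def)
  then have card_e: "card ?e = k"
    using k by (subst card_image) (auto intro: inj_on_subset)
  have unif: "uniform k ?K"
    using H(2) card_e unfolding uniform_def eK by blast
  have new: "?e \<notin> edges ?H"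
  proof
    assume "?e \<in> edges ?H"
    then have "?e \<subseteq> verts ?H" using hypertree_finite(3)[OF H(1)] by blast
    then have "?e = {f (n * (k - 1))}" using meet by blast
    then have "card ?e = 1" by (metis card_1_singleton_iff One_nat_def)
    then show False using card_e k by simp
  qed
  \<comment> \<open>Only the first edge of a branch contains the centre, so the degree rises just
    when the length leaves 0.\<close>
  have "0 \<in> ?e \<longleftrightarrow> n = 0"
  proof -
    have "0 \<in> ?e \<longleftrightarrow> 0 \<in> {n * (k - 1)..Suc n * (k - 1)}" by (auto simp: f_def image_iff split: if_splits)
    then show ?thesis using k by simp
  qed
  then have "{e \<in> edges ?K. 0 \<in> e} =
      (if n = 0 then insert ?e {e \<in> edges ?H. 0 \<in> e} else {e \<in> edges ?H. 0 \<in> e})"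
    unfolding eK by auto
  moreover have "finite (edges ?H)" by (rule hypertree_finite(2)[OF H(1)])
  ultimately have deg: "degree ?K 0 = length (filter (\<lambda>n. n \<noteq> 0) (ns @ [Suc n]))"
    using H(5) new by (simp add: degree_def split: if_splits)
  have "card (edges ?K) = sum_list (ns @ [Suc n])"
    unfolding eK using \<open>finite (edges ?H)\<close> new H(3) by simp
  moreover have "verts ?K = {0..sum_list (ns @ [Suc n]) * (k - 1)}"
  proof -
    have "f ` {n * (k - 1)<..Suc n * (k - 1)} = (\<lambda>v. sum_list ns * (k - 1) + v) ` {n * (k - 1)<..Suc n * (k - 1)}"
      by (rule image_cong) (auto simp: f_def)
    also have "\<dots> = {?N<..?N + (k - 1)}"
    proof -
      have "sum_list ns * (k - 1) + n * (k - 1) = ?N"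
        and "sum_list ns * (k - 1) + Suc n * (k - 1) = ?N + (k - 1)"
        by (simp_all add: add_mult_distrib)
      then show ?thesis unfolding image_add_greaterThanAtMost by (simp only:)
    qed
    finally have "verts ?K = {0..?N} \<union> {?N<..?N + (k - 1)}"
      unfolding vK range image_insert using H(4) f_first by auto
    also have "\<dots> = {0..?N + (k - 1)}" by auto
    finally show ?thesis by (simp add: add_mult_distrib add.commute add.left_commute)
  qed
  ultimately show ?thesis
    using tree unif deg by (simp only: starlike_spec_def simp_thms)
qed

lemma starlike_satisfies_spec:
  assumes "ns \<noteq> []" and "k \<ge> 2"
  shows "starlike_spec k ns (starlike k ns)"
  using assms(1)
proof (induction ns rule: rev_induct)
  case (snoc n ns)
  show ?case
    \<comment> \<open>An inner induction on the last length: it starts with an empty branch and adds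
      one edge at a time.\<close>
    by (induction n) (use snoc.IH starlike_snoc_0 starlike_snoc_Suc assms(2) in blast)+
qed simp

lemma starlike_in_class:
  assumes "ns \<noteq> []" and "k \<ge> 2"
  shows "starlike k ns \<in> uniform_hypertrees k (sum_list ns)"
    and "degree (starlike k ns) 0 = length (filter (\<lambda>n. n \<noteq> 0) ns)"
    and "0 \<in> verts (starlike k ns)"
  using starlike_satisfies_spec[OF assms] by (simp_all add: starlike_spec_def uniform_hypertrees_def)

section \<open>The second last hypertree\<close>

text \<open>The trace of order 0 depends on the number of vertices, that of order 1 on the degree
  sum; both agree within the class. At order 2 the graph-case term depends on \<open>m\<close>
  alone, so the squared degrees decide.\<close>

lemma S_less_if_excess_less:
  fixes H :: "('a::linorder) hypergraph" and K :: "('b::linorder) hypergraph"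
  assumes H: "H \<in> uniform_hypertrees k m" and K: "K \<in> uniform_hypertrees k m"
    and k: "k \<ge> 2" and m: "m \<ge> 3" and \<alpha>: "0 < \<alpha>"
    and less: "(\<Sum>v\<in>verts H. (degree H v - 1)\<^sup>2) < (\<Sum>v\<in>verts K. (degree K v - 1)\<^sup>2)"
  shows "S_less k \<alpha> H K"
proof -
  have m1: "m \<ge> 1" using m by simp
  let ?n = "m * (k - 1) + 1"
  have n: "card (verts H) = ?n" "card (verts K) = ?n"
    using class_card_verts[OF H k m1] class_card_verts[OF K k m1] by auto
  have hg: "hypergraph H" "hypergraph K"
    using class_hypertree[OF H k m1] class_hypertree[OF K k m1] by (auto simp: hypertree_def)
  note unif = class_uniform[OF H k m1] class_uniform[OF K k m1]
  note fin = class_finite(1)[OF H k m1] class_finite(1)[OF K k m1]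
  let ?c = "real ((k - 1) ^ (?n - 1))"
  have "(\<Sum>v\<in>verts H. real (degree H v)) = real (m * k)" "(\<Sum>v\<in>verts K. real (degree K v)) = real (m * k)"
    using class_degree_sum[OF H k m1] class_degree_sum[OF K k m1] by (metis of_nat_sum)+
  then have tr1: "tensor_trace (verts H) k (A_alpha k \<alpha> H) 1 = tensor_trace (verts K) k (A_alpha k \<alpha> K) 1"
    using tensor_trace_1[OF fin(1) unif(1) k] tensor_trace_1[OF fin(2) unif(2) k] n by simp
  have "(\<Sum>v\<in>verts H. (degree H v)\<^sup>2) < (\<Sum>v\<in>verts K. (degree K v)\<^sup>2)"
    using less class_degree_square_sum[OF H k m1] class_degree_square_sum[OF K k m1] by linarith
  then have "\<alpha>\<^sup>2 * real (\<Sum>v\<in>verts H. (degree H v)\<^sup>2) < \<alpha>\<^sup>2 * real (\<Sum>v\<in>verts K. (degree K v)\<^sup>2)"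
    using \<alpha> by (intro mult_strict_left_mono) (simp_all only: of_nat_less_iff zero_less_power)
  moreover have "?c > 0" using k by simp
  ultimately have tr2: "tensor_trace (verts H) k (A_alpha k \<alpha> H) 2 < tensor_trace (verts K) k (A_alpha k \<alpha> K) 2"
    unfolding tensor_trace_2[OF hg(1) unif(1) k] tensor_trace_2[OF hg(2) unif(2) k] n
      class_card_edges[OF H k m1] class_card_edges[OF K k m1]
    by (intro mult_strict_left_mono[OF add_strict_right_mono])
  \<comment> \<open>Ensures that 2 is an admissible order, that is, at most the number of
    eigenvalues minus 1.\<close>
  have "3 * 1 \<le> m * (k - 1)" using m k by (intro mult_le_mono) auto
  moreover have "(k - 1) ^ (?n - 1) \<ge> 1" using k by simp
  ultimately have "3 * 1 \<le> ?n * (k - 1) ^ (?n - 1)" by (intro mult_le_mono) auto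
  then have "2 \<in> {1..card (verts H) * (k - 1) ^ (card (verts H) - 1) - 1}"
    unfolding n by (simp only: atLeastAtMost_iff) linarith
  moreover have "tensor_trace (verts H) k (A_alpha k \<alpha> H) t = tensor_trace (verts K) k (A_alpha k \<alpha> K) t"
    if "t < 2" for t
  proof -
    have "t = 0 \<or> t = 1" using that by linarith
    then show ?thesis using tr1 n by (auto simp: tensor_trace_def[where d = 0])
  qed
  ultimately show ?thesis
    unfolding S_less_def using n tr2 by (intro conjI bexI[of _ 2] allI impI) auto
qed

theorem theorem6p6:
  fixes k m :: nat and \<alpha> :: real
  assumes "k \<ge> 2" and "m \<ge> 3" and "0 < \<alpha>" and "\<alpha> < 1"
  shows "S_second_last k \<alpha> (uniform_hypertrees k m :: nat hypergraph set)
           (starlike k (1 # 2 # replicate (m - 3) 1))"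
proof -
  let ?C = "uniform_hypertrees k m :: nat hypergraph set"
  let ?L = "starlike k (replicate m 1)" and ?X = "starlike k (1 # 2 # replicate (m - 3) 1)"
  let ?q = "\<lambda>H :: nat hypergraph. \<Sum>v\<in>verts H. (degree H v - 1)\<^sup>2"
  have m1: "m \<ge> 1" and m2: "m \<ge> 2" using assms(2) by auto
  note k = assms(1)
  have "replicate m 1 \<noteq> ([] :: nat list)" using m1 by auto
  then have L: "?L \<in> ?C" "degree ?L 0 = m" "0 \<in> verts ?L"
    using starlike_in_class[of "replicate m 1" k] k by (simp_all add: sum_list_replicate)
  have "sum_list (1 # 2 # replicate (m - 3) 1) = m"
    using assms(2) by (simp add: sum_list_replicate)
  then have X: "?X \<in> ?C" "degree ?X 0 = m - 1" "0 \<in> verts ?X"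
    using starlike_in_class[of "1 # 2 # replicate (m - 3) 1" k] assms(2) k
    by (simp_all only: list.distinct simp_thms) simp
  have qL: "?q ?L \<ge> (m - 1)\<^sup>2"
    using class_excess_ge[OF L(1) k m1 L(3)] L(2) by simp
  \<comment> \<open>The centre has excess \<open>m - 2\<close>; the single remaining unit of excess
    gives the summand 1.\<close>
  have qX: "?q ?X \<ge> (m - 2)\<^sup>2 + 1"
    using class_excess_ge[OF X(1) k m1 X(3)] X(2) assms(2) by (simp add: numeral_2_eq_2)
  have last: "S_less k \<alpha> H ?L" if H: "H \<in> ?C" and not_L: "\<not> hypergraph_iso H ?L" for H
  proof -
    \<comment> \<open>A vertex of degree \<open>m\<close> would make \<open>H\<close> a
      hyperstar.\<close>
    have deg: "degree H v - 1 \<le> m - 2" for v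
    proof -
      have "degree H v \<noteq> m" using full_degree_iso[OF H L(1) k m1 _ L(2)] not_L by blast
      then show ?thesis using class_degree_le[OF H k m1, of v] by linarith
    qed
    have "?q H \<le> (m - 2) * (m - 1)"
      by (rule class_excess_le[OF H k m1 deg])
    also have "\<dots> < (m - 1)\<^sup>2"
      unfolding power2_eq_square using assms(2) by (intro mult_strict_right_mono) auto
    finally show ?thesis
      using qL by (intro S_less_if_excess_less[OF H L(1) k assms(2,3)]) linarith
  qed
  have "\<not> hypergraph_iso ?X ?L"
  proof
    assume "hypergraph_iso ?X ?L"
    then obtain f where f: "bij_betw f (verts ?X) (verts ?L)" "edges ?L = (\<lambda>e. f ` e) ` edges ?X"
      unfolding hypergraph_iso_def by blast
    have "0 \<in> f ` verts ?X" using f(1) L(3) by (simp only: bij_betw_def)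
    then obtain v where v: "v \<in> verts ?X" "f v = 0" by (metis imageE)
    have "hypergraph ?X" using class_hypertree[OF X(1) k m1] by (simp add: hypertree_def)
    then have deg_v: "degree ?X v = m" using degree_iso[OF _ f v(1)] v(2) L(2) by simp
    have "v \<noteq> 0"
    proof
      assume "v = 0"
      then have "m - 1 = m" using deg_v X(2) by (simp only:)
      then show False using m1 by simp
    qed
    \<comment> \<open>Vertices of degrees \<open>m - 1\<close> and \<open>m\<close> together have
      excess \<open>(m - 2) + (m - 1)\<close>, which exceeds the total \<open>m - 1\<close> since
      \<open>m \<ge> 3\<close>.\<close>
    have "(\<Sum>u\<in>{0, v}. degree ?X u - 1) \<le> (\<Sum>u\<in>verts ?X. degree ?X u - 1)"
      by (rule sum_mono2) (use class_finite(1)[OF X(1) k m1] X(3) v(1) in auto)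
    then show False
      using class_excess_sum[OF X(1) k m1] \<open>v \<noteq> 0\<close> deg_v X(2) assms(2) by simp
  qed
  moreover have "S_less k \<alpha> H ?X"
    if H: "H \<in> ?C" and not_X: "\<not> hypergraph_iso H ?X" and not_L: "\<not> hypergraph_iso H ?L" for H
  proof -
    \<comment> \<open>Degree \<open>m\<close> forces the hyperstar and degree \<open>m - 1\<close>
      forces \<open>?X\<close>, so every degree is at most \<open>m - 2\<close>.\<close>
    have deg: "degree H v - 1 \<le> m - 3" for v
    proof -
      have "degree H v \<noteq> m" using full_degree_iso[OF H L(1) k m1 _ L(2)] not_L by blast
      moreover have "degree H v \<noteq> m - 1" using broom_iso[OF H X(1) k m2 _ X(2)] not_X by blast
      ultimately show ?thesis using class_degree_le[OF H k m1, of v] by linarith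
    qed
    have "?q H \<le> (m - 3) * (m - 1)"
      by (rule class_excess_le[OF H k m1 deg])
    also have "\<dots> < (m - 2)\<^sup>2 + 1"
    proof -
      \<comment> \<open>Removes the truncated differences: the claim becomes
        \<open>r * (r + 2) < (r + 1) * (r + 1) + 1\<close>.\<close>
      obtain r where "m = r + 3" using assms(2) by (metis le_add_diff_inverse2)
      then show ?thesis by (simp add: power2_eq_square)
    qed
    finally show ?thesis
      using qX by (intro S_less_if_excess_less[OF H X(1) k assms(2,3)]) linarith
  qed
  ultimately show ?thesis
    unfolding S_second_last_def S_last_def using L(1) X(1) last by blast
qed

end
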